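(* Let $E$ be a complex Banach lattice and let $(e^{tA})_{t \in [0,\infty)}$ be a uniformly eventually positive $C_0$-semigroup on $E$ which is bounded and norm continuous at infinity. Then the following are equivalent: (i) The limit $\lim_{t \to \infty} e^{tA}f$ exists for every $f \in E$. (ii) The semigroup is mean ergodic.
   Context: A $C_0$-semigroup $(e^{tA})_{t\ge 0}$ on a complex Banach lattice $E$ is uniformly eventually positive if there exists $t_0 \ge 0$ such that $e^{tA}$ is a positive operator (i.e. $e^{tA}f \ge 0$ for all $0\le f\in E$) for every $t \ge t_0$. Let $\omega_0(A)$ denote the growth bound of the semigroup. The semigroup is called norm continuous at infinity if $\omega_0(A) > -\infty$ and the rescaled semigroup $S(t) := e^{t(A-\omega_0(A)I)}$ satisfies $\limsup_{s \to 0} \|S(t) - S(t+s)\| \to 0$ as $t \to \infty$ (the phrase "norm continuous at infinity" always tacitly includes $\omega_0(A) > -\infty$). The semigroup is called mean ergodic if for every $f \in E$ the Cesàro means $\frac{1}{t}\int_0^t e^{sA}f\,ds$ converge in norm as $t \to \infty$. *)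

theory Defs
  imports "HOL-Analysis.Analysis"
begin

class banach_lattice = banach + ordered_real_vector + lattice +
  assumes lattice_norm: "sup x (- x) \<le> sup y (- y) \<Longrightarrow> norm x \<le> norm y"

text \<open>The complex Banach lattice E is the complexification of a real Banach
  lattice E_R; its elements are pairs (x, y) standing for x + i y.
  The Banach space structure on pairs is the product one (its norm is
  equivalent to the modulus norm of the complexification).\<close>

definition cscale :: "complex \<Rightarrow> 'a::real_vector \<times> 'a \<Rightarrow> 'a \<times> 'a" where
  "cscale c f = (Re c *\<^sub>R fst f - Im c *\<^sub>R snd f, Im c *\<^sub>R fst f + Re c *\<^sub>R snd f)"

definition complex_bounded_linear :: "('a::real_normed_vector \<times> 'a \<Rightarrow> 'a \<times> 'a) \<Rightarrow> bool" where
  "complex_bounded_linear T \<longleftrightarrow> bounded_linear T \<and> (\<forall>c f. T (cscale c f) = cscale c (T f))"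

definition cpos :: "'a::{real_vector, order} \<times> 'a \<Rightarrow> bool" where
  "cpos f \<longleftrightarrow> snd f = 0 \<and> 0 \<le> fst f"

definition positive_op :: "('a::{real_vector, order} \<times> 'a \<Rightarrow> 'a \<times> 'a) \<Rightarrow> bool" where
  "positive_op T \<longleftrightarrow> (\<forall>f. cpos f \<longrightarrow> cpos (T f))"

definition C0_semigroup :: "(real \<Rightarrow> 'a::real_normed_vector \<times> 'a \<Rightarrow> 'a \<times> 'a) \<Rightarrow> bool" where
  "C0_semigroup T \<longleftrightarrow>
     (\<forall>t\<ge>0. complex_bounded_linear (T t)) \<and>
     T 0 = id \<and>
     (\<forall>s\<ge>0. \<forall>t\<ge>0. T (s + t) = T s \<circ> T t) \<and>
     (\<forall>f. continuous_on {0..} (\<lambda>t. T t f))"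

definition uniformly_eventually_positive :: "(real \<Rightarrow> 'a::{real_vector, order} \<times> 'a \<Rightarrow> 'a \<times> 'a) \<Rightarrow> bool" where
  "uniformly_eventually_positive T \<longleftrightarrow> (\<exists>t0\<ge>0. \<forall>t\<ge>t0. positive_op (T t))"

definition bounded_semigroup :: "(real \<Rightarrow> 'a::real_normed_vector \<times> 'a \<Rightarrow> 'a \<times> 'a) \<Rightarrow> bool" where
  "bounded_semigroup T \<longleftrightarrow> (\<exists>M. \<forall>t\<ge>0. onorm (T t) \<le> M)"

definition growth_bound :: "(real \<Rightarrow> 'a::real_normed_vector \<times> 'a \<Rightarrow> 'a \<times> 'a) \<Rightarrow> ereal" where
  "growth_bound T = Inf {ereal \<omega> | \<omega>. \<exists>M. \<forall>t\<ge>0. onorm (T t) \<le> M * exp (\<omega> * t)}"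

definition norm_continuous_at_infinity :: "(real \<Rightarrow> 'a::real_normed_vector \<times> 'a \<Rightarrow> 'a \<times> 'a) \<Rightarrow> bool" where
  "norm_continuous_at_infinity T \<longleftrightarrow>
     growth_bound T > - \<infinity> \<and>
     (let \<omega> = real_of_ereal (growth_bound T);
          S = (\<lambda>t f. exp (- \<omega> * t) *\<^sub>R T t f)
      in ((\<lambda>t. Limsup (at (0::real)) (\<lambda>s. ereal (onorm (\<lambda>f. S t f - S (t + s) f))))
            \<longlongrightarrow> 0) at_top)"

definition mean_ergodic :: "(real \<Rightarrow> 'a::banach \<times> 'a \<Rightarrow> 'a \<times> 'a) \<Rightarrow> bool" where
  "mean_ergodic T \<longleftrightarrow>
     (\<forall>f. \<exists>g. ((\<lambda>t. (1 / t) *\<^sub>R integral {0..t} (\<lambda>s. T s f)) \<longlongrightarrow> g) at_top)"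

end

theory Submission
  imports Defs "HOL-Library.Lattice_Algebras" "HOL-Library.Function_Algebras"
begin

text \<open>
  The heart of the matter is that \<open>T (t + s) f - T t f\<close> tends to 0 for every \<open>s\<close>; mean ergodicity
  then upgrades this to convergence, because the Cesaro means of the orbit of \<open>f\<close> differ from \<open>f\<close>
  by averages of the vectors \<open>T s f - f\<close>.

  A positive functional on the bounded continuous functions of time turns the orbits into a bounded
  two-sided trajectory of positive functionals, and it suffices that every such trajectory is
  constant. The trajectories form the positive cone of a lattice on which the shift \<open>V\<close> by a small
  time and its inverse act positively, and norm continuity at infinity makes \<open>V\<close> close to the
  identity in norm. If \<open>\<phi>\<close> and \<open>\<psi>\<close> are disjoint and \<open>u = V\<^sup>-\<^sup>1\<phi> \<and> \<psi>\<close>, then \<open>Vu \<le> \<phi>\<close> is disjoint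
  from \<open>u\<close>, which forces \<open>u = 0\<close>; so \<open>V\<^sup>-\<^sup>1\<close> preserves disjointness. For \<open>c > 1\<close> and
  \<open>p = (Vf - cf)\<^sup>+\<close> this gives \<open>c\<^sup>n V\<^sup>-\<^sup>n p \<le> Vf\<close> for all \<open>n\<close>, so boundedness yields \<open>p = 0\<close>.
  Hence \<open>Vf \<le> f\<close>, and the same argument for \<open>V\<^sup>-\<^sup>1\<close> gives \<open>Vf = f\<close>.
\<close>

section \<open>Banach lattices\<close>

subclass (in banach_lattice) lattice_ab_group_add ..

lemma pprt_diff_pprt_uminus:
  fixes x :: "'a::lattice_ab_group_add"
  shows "pprt x - pprt (- x) = x"
  using prts[of x] by (simp add: pprt_neg)

lemma pprt_add_le:
  fixes x y :: "'a::lattice_ab_group_add"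
  shows "pprt (x + y) \<le> pprt x + pprt y"
  unfolding pprt_def by (intro sup_least add_mono add_nonneg_nonneg) auto

lemma pprt_scaleR:
  fixes x :: "'a::{ordered_real_vector, lattice_ab_group_add}"
  assumes "0 < c"
  shows "pprt (c *\<^sub>R x) = c *\<^sub>R pprt x"
proof (rule antisym)
  have pprt_scaleR_le: "pprt (b *\<^sub>R y) \<le> b *\<^sub>R pprt y" if "0 < b" for b and y :: 'a
    using that by (auto simp: pprt_def intro!: scaleR_left_mono scaleR_nonneg_nonneg)
  show "pprt (c *\<^sub>R x) \<le> c *\<^sub>R pprt x"
    using assms by (rule pprt_scaleR_le)
  have "c *\<^sub>R pprt ((1 / c) *\<^sub>R c *\<^sub>R x) \<le> c *\<^sub>R (1 / c) *\<^sub>R pprt (c *\<^sub>R x)"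
    using assms by (intro scaleR_left_mono pprt_scaleR_le) auto
  then show "c *\<^sub>R pprt x \<le> pprt (c *\<^sub>R x)"
    using assms by simp
qed

lemma riesz_decomposition:
  fixes y a b :: "'a::lattice_ab_group_add"
  assumes "0 \<le> y" "y \<le> a + b" "0 \<le> a" "0 \<le> b"
  obtains y1 y2 where "y = y1 + y2" "0 \<le> y1" "y1 \<le> a" "0 \<le> y2" "y2 \<le> b"
proof
  show "y = inf y a + (y - inf y a)" by (subst add.commute) (rule diff_add_cancel[symmetric])
  have "y - b \<le> inf y a"
    using assms by (simp add: algebra_simps)
  then show "y - inf y a \<le> b" by (simp only: diff_le_eq add.commute)
  show "0 \<le> y - inf y a" by (simp only: diff_ge_0_iff_ge inf_le1)
qed (use assms in auto)

lemma norm_mono_nonneg: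
  fixes x y :: "'a::banach_lattice"
  assumes "0 \<le> x" "x \<le> y"
  shows "norm x \<le> norm y"
proof (rule lattice_norm)
  have "0 \<le> y" using assms by (rule order_trans)
  then show "sup x (- x) \<le> sup y (- y)"
    using assms by (simp add: sup_absorb1 minus_le_self_iff)
qed

lemma norm_pprt_le:
  fixes x :: "'a::banach_lattice"
  shows "norm (pprt x) \<le> norm x"
proof (rule lattice_norm)
  have "x + - x \<le> sup x (- x) + sup x (- x)"
    by (intro add_mono) auto
  then have "0 \<le> sup x (- x)" by (simp del: le_sup_iff)
  then show "sup (pprt x) (- pprt x) \<le> sup x (- x)"
    by (simp add: sup_absorb1 minus_le_self_iff) (simp add: pprt_def)
qed

section \<open>The Hahn-Banach theorem\<close>

definition sublinear :: "('v::real_vector \<Rightarrow> real) \<Rightarrow> bool" where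
  "sublinear p \<longleftrightarrow> (\<forall>x y. p (x + y) \<le> p x + p y) \<and> (\<forall>c>0. \<forall>x. p (c *\<^sub>R x) = c * p x)"

lemma sublinearI:
  assumes "\<And>x y. p (x + y) \<le> p x + p y"
    and scaleR_le: "\<And>c x. 0 < c \<Longrightarrow> p (c *\<^sub>R x) \<le> c * p x"
  shows "sublinear p"
proof -
  have "c * p x \<le> p (c *\<^sub>R x)" if "0 < c" for c x
    using scaleR_le[of "1 / c" "c *\<^sub>R x"] that by (simp add: field_simps)
  then have "p (c *\<^sub>R x) = c * p x" if "0 < c" for c x
    using that by (intro antisym scaleR_le)
  with assms(1) show ?thesis unfolding sublinear_def by blast
qed

lemma sublinear_add: "sublinear p \<Longrightarrow> p (x + y) \<le> p x + p y"
  by (simp add: sublinear_def)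

lemma sublinear_scaleR: "sublinear p \<Longrightarrow> 0 < c \<Longrightarrow> p (c *\<^sub>R x) = c * p x"
  by (simp add: sublinear_def)

lemma sublinear_zero: "sublinear p \<Longrightarrow> p 0 = 0"
  using sublinear_scaleR[of p 2 0] by simp

lemma sublinear_minus: "sublinear p \<Longrightarrow> - p (- x) \<le> p x"
  using sublinear_add[of p x "- x"] by (simp add: sublinear_zero)

lemma sublinear_INF:
  fixes p :: "'i \<Rightarrow> 'v::real_vector \<Rightarrow> real"
  assumes "I \<noteq> {}"
    and bdd: "\<And>x. bdd_below ((\<lambda>i. p i x) ` I)"
    and add: "\<And>i j x y. i \<in> I \<Longrightarrow> j \<in> I \<Longrightarrow> \<exists>k\<in>I. p k (x + y) \<le> p i x + p j y"
    and scaleR: "\<And>i c x. i \<in> I \<Longrightarrow> 0 < c \<Longrightarrow> \<exists>k\<in>I. p k (c *\<^sub>R x) \<le> c * p i x"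
  shows "sublinear (\<lambda>x. INF i\<in>I. p i x)"
proof (rule sublinearI)
  fix x y
  let ?q = "\<lambda>x. INF i\<in>I. p i x"
  have "?q (x + y) \<le> p i x + p j y" if "i \<in> I" "j \<in> I" for i j
    using add[OF that] cINF_lower2[OF bdd] by blast
  then have "?q (x + y) - p j y \<le> ?q x" if "j \<in> I" for j
    using that assms(1) by (intro cINF_greatest) (auto simp: diff_le_eq)
  then have "?q (x + y) - ?q x \<le> ?q y"
    using assms(1) by (intro cINF_greatest) (auto simp: algebra_simps)
  then show "?q (x + y) \<le> ?q x + ?q y" by simp
next
  fix c :: real and x assume c: "0 < c"
  let ?q = "\<lambda>x. INF i\<in>I. p i x"
  have "?q (c *\<^sub>R x) \<le> c * p i x" if "i \<in> I" for i
    using scaleR[OF that c] cINF_lower2[OF bdd] by blast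
  then have "?q (c *\<^sub>R x) / c \<le> ?q x"
    using assms(1) c by (intro cINF_greatest) (auto simp: field_simps)
  then show "?q (c *\<^sub>R x) \<le> c * ?q x" using c by (simp add: field_simps)
qed

lemma sublinear_refine:
  fixes p :: "'v::real_vector \<Rightarrow> real"
  assumes p: "sublinear p"
  obtains q where "sublinear q" "q \<le> p" "q (- y) \<le> - p y" "\<And>x. q x \<le> p (x + y) - p y"
proof -
  define r where "r t x = p (x + t *\<^sub>R y) - t * p y" for t x
  define q where "q x = (INF t\<in>{0..}. r t x)" for x
  have "- p (- x) \<le> r t x" if "0 \<le> t" for t x
  proof -
    have "t * p y = p (t *\<^sub>R y)"
      using that by (cases "t = 0") (simp_all add: sublinear_scaleR[OF p] sublinear_zero[OF p])
    also have "\<dots> \<le> p (x + t *\<^sub>R y) + p (- x)"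
      using sublinear_add[OF p, of "x + t *\<^sub>R y" "- x"] by simp
    finally show ?thesis by (simp add: r_def)
  qed
  then have bdd: "bdd_below ((\<lambda>t. r t x) ` {0..})" for x
    by (intro bdd_belowI2) auto
  have r_add: "r (s + t) (x + z) \<le> r s x + r t z" for s t x z
    using sublinear_add[OF p, of "x + s *\<^sub>R y" "z + t *\<^sub>R y"] by (simp add: r_def algebra_simps)
  have r_scaleR: "r (c * t) (c *\<^sub>R x) = c * r t x" if "0 < c" for c t x
    using sublinear_scaleR[OF p that, of "x + t *\<^sub>R y"] by (simp add: r_def algebra_simps)
  have "sublinear q"
    unfolding q_def
  proof (rule sublinear_INF[OF _ bdd])
    show "\<exists>k\<in>{0..}. r k (x + z) \<le> r s x + r t z" if "s \<in> {0..}" "t \<in> {0..}" for s t x z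
      using that r_add by (intro bexI[of _ "s + t"]) auto
    show "\<exists>k\<in>{0..}. r k (c *\<^sub>R x) \<le> c * r t x" if "t \<in> {0..}" "0 < c" for t c x
      using that r_scaleR by (intro bexI[of _ "c * t"]) auto
  qed simp
  moreover have q_le: "q x \<le> r t x" if "0 \<le> t" for t x
    unfolding q_def using that by (intro cINF_lower[OF bdd]) auto
  have "q \<le> p" using q_le[of 0] by (simp add: le_fun_def r_def)
  moreover have "q (- y) \<le> - p y" using q_le[of 1 "- y"] by (simp add: r_def sublinear_zero[OF p])
  moreover have "q x \<le> p (x + y) - p y" for x using q_le[of 1 x] by (simp add: r_def)
  ultimately show thesis using that by blast
qed

lemma chain_sublinear_lower_bound:
  fixes p :: "'v::real_vector \<Rightarrow> real"
  assumes "C \<noteq> {}" and sublinear: "\<And>q. q \<in> C \<Longrightarrow> sublinear q" and le: "\<And>q. q \<in> C \<Longrightarrow> q \<le> p"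
    and chain: "\<And>q r. q \<in> C \<Longrightarrow> r \<in> C \<Longrightarrow> q \<le> r \<or> r \<le> q"
  obtains u where "sublinear u" "\<And>q. q \<in> C \<Longrightarrow> u \<le> q"
proof
  let ?u = "\<lambda>x. INF q\<in>C. q x"
  have bdd: "bdd_below ((\<lambda>q. q x) ` C)" for x
  proof (rule bdd_belowI2)
    fix q assume q: "q \<in> C"
    have "q (- x) \<le> p (- x)" using le[OF q] by (rule le_funD)
    then show "- p (- x) \<le> q x" using sublinear_minus[OF sublinear[OF q], of x] by linarith
  qed
  show "sublinear ?u"
  proof (rule sublinear_INF[OF assms(1) bdd])
    fix q r x y assume "q \<in> C" "r \<in> C"
    moreover from this obtain s where s: "s \<in> C" "s \<le> q" "s \<le> r"
      using chain by blast
    ultimately have "s (x + y) \<le> q x + r y"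
      using sublinear_add[OF sublinear, of s x y] by (meson add_mono le_funD order_trans)
    then show "\<exists>s\<in>C. s (x + y) \<le> q x + r y" using s(1) by blast
  next
    show "\<exists>r\<in>C. r (c *\<^sub>R x) \<le> c * q x" if "q \<in> C" "0 < c" for q c x
      using that by (auto simp: sublinear_scaleR[OF sublinear] intro!: bexI[of _ q])
  qed
  show "?u \<le> q" if "q \<in> C" for q
    using that by (auto intro!: le_funI cINF_lower[OF bdd])
qed

lemma minimal_sublinear_exists:
  fixes p :: "'v::real_vector \<Rightarrow> real"
  assumes p: "sublinear p"
  obtains m where "sublinear m" "m \<le> p" "\<And>q. sublinear q \<Longrightarrow> q \<le> m \<Longrightarrow> q = m"
proof -
  let ?A = "{q. sublinear q \<and> q \<le> p}"
  have "\<exists>m\<in>?A. \<forall>q\<in>?A. q \<le> m \<longrightarrow> q = m"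
  proof (rule predicate_Zorn)
    show "partial_order_on ?A (relation_of (\<lambda>q r. r \<le> q) ?A)"
      by (rule partial_order_on_relation_ofI) auto
    show "\<exists>u\<in>?A. \<forall>q\<in>C. u \<le> q" if "C \<in> Chains (relation_of (\<lambda>q r. r \<le> q) ?A)" for C
    proof (cases "C = {}")
      case False
      have C: "q \<in> ?A" "q \<le> r \<or> r \<le> q" if "q \<in> C" "r \<in> C" for q r
        using \<open>C \<in> Chains _\<close> that by (auto simp: Chains_def relation_of_def)
      then obtain u where u: "sublinear u" "\<And>q. q \<in> C \<Longrightarrow> u \<le> q"
        using chain_sublinear_lower_bound[OF False, of p] by blast
      obtain q where q: "q \<in> C" using False by blast
      then have "u \<le> p" using u(2)[OF q] C(1)[OF q q] by (auto intro: order_trans)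
      then show ?thesis using u by blast
    qed (use p in auto)
  qed
  then obtain m where m: "sublinear m" "m \<le> p" "\<And>q. sublinear q \<Longrightarrow> q \<le> p \<Longrightarrow> q \<le> m \<Longrightarrow> q = m"
    by blast
  then show thesis using that[of m] order_trans[OF _ m(2)] by blast
qed

text \<open>A minimal sublinear functional is additive, since no refinement makes it smaller.\<close>

theorem hahn_banach_sublinear:
  fixes p :: "'v::real_vector \<Rightarrow> real"
  assumes p: "sublinear p"
  obtains \<phi> where "linear \<phi>" "\<phi> \<le> p" "\<phi> y = p y"
proof -
  obtain q where q: "sublinear q" "q \<le> p" "q (- y) \<le> - p y"
    using sublinear_refine[OF p] by metis
  obtain m where m: "sublinear m" "m \<le> q" and minimal: "\<And>q. sublinear q \<Longrightarrow> q \<le> m \<Longrightarrow> q = m"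
    using minimal_sublinear_exists[OF q(1)] by metis
  have add: "m (x + z) = m x + m z" for x z
  proof (rule antisym[OF sublinear_add[OF m(1)]])
    obtain q' where "sublinear q'" "q' \<le> m" "q' x \<le> m (x + z) - m z"
      using sublinear_refine[OF m(1)] by metis
    with minimal[of q'] show "m x + m z \<le> m (x + z)" by simp
  qed
  have uminus: "m (- x) = - m x" for x
    using add[of x "- x"] sublinear_zero[OF m(1)] by simp
  have "m (c *\<^sub>R x) = c *\<^sub>R m x" for c x
  proof (cases c "0::real" rule: linorder_cases)
    case less
    then have "m ((- c) *\<^sub>R x) = - c * m x" by (intro sublinear_scaleR[OF m(1)]) auto
    then show ?thesis using uminus[of "c *\<^sub>R x"] by simp
  qed (auto simp: sublinear_scaleR[OF m(1)] sublinear_zero[OF m(1)])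
  then have "linear m" using add by (intro linearI)
  moreover have "m \<le> p" using m(2) q(2) by (rule order_trans)
  moreover have "p y \<le> m y"
    using le_funD[OF m(2), of "- y"] q(3) uminus[of y] by simp
  ultimately show thesis
    using that by (metis antisym le_funD)
qed

section \<open>The asymptotic size of the positive part\<close>

definition eventual_pprt_bounds ::
  "'b filter \<Rightarrow> ('b::topological_space \<Rightarrow>\<^sub>C 'a::banach_lattice) \<Rightarrow> real set" where
  "eventual_pprt_bounds F y = {c. 0 \<le> c \<and> (\<forall>\<^sub>F t in F. norm (pprt (apply_bcontfun y t)) \<le> c)}"

definition limsup_pprt :: "'b filter \<Rightarrow> ('b::topological_space \<Rightarrow>\<^sub>C 'a::banach_lattice) \<Rightarrow> real" where
  "limsup_pprt F y = Inf (eventual_pprt_bounds F y)"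

lemma limsup_pprt_le:
  assumes "0 \<le> c" "\<forall>\<^sub>F t in F. norm (pprt (apply_bcontfun y t)) \<le> c"
  shows "limsup_pprt F y \<le> c"
  unfolding limsup_pprt_def eventual_pprt_bounds_def
  using assms by (intro cInf_lower bdd_belowI[of _ 0]) auto

lemma eventual_pprt_bounds_nonempty: "eventual_pprt_bounds F y \<noteq> {}"
proof -
  have "norm (pprt (apply_bcontfun y t)) \<le> norm y" for t
    by (rule order_trans[OF norm_pprt_le norm_bounded])
  then have "norm y \<in> eventual_pprt_bounds F y" by (simp add: eventual_pprt_bounds_def)
  then show ?thesis by blast
qed

lemma limsup_pprt_nonneg: "0 \<le> limsup_pprt F y"
  unfolding limsup_pprt_def
  by (rule cInf_greatest[OF eventual_pprt_bounds_nonempty]) (simp add: eventual_pprt_bounds_def)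

lemma eventually_norm_pprt_less:
  assumes "limsup_pprt F y < c"
  shows "\<forall>\<^sub>F t in F. norm (pprt (apply_bcontfun y t)) < c"
proof -
  obtain d where "d < c" "\<forall>\<^sub>F t in F. norm (pprt (apply_bcontfun y t)) \<le> d"
    using cInf_lessD[OF eventual_pprt_bounds_nonempty assms[unfolded limsup_pprt_def]]
    by (auto simp: eventual_pprt_bounds_def)
  then show ?thesis by (auto elim!: eventually_mono)
qed

lemma sublinear_limsup_pprt:
  "sublinear (limsup_pprt F :: ('b::topological_space \<Rightarrow>\<^sub>C 'a::banach_lattice) \<Rightarrow> real)"
proof (rule sublinearI; rule field_le_epsilon)
  fix x y :: "'b \<Rightarrow>\<^sub>C 'a" and e :: real assume e: "0 < e"
  have "\<forall>\<^sub>F t in F. norm (pprt (apply_bcontfun x t)) < limsup_pprt F x + e / 2"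
    "\<forall>\<^sub>F t in F. norm (pprt (apply_bcontfun y t)) < limsup_pprt F y + e / 2"
    using e by (auto intro!: eventually_norm_pprt_less)
  then have "\<forall>\<^sub>F t in F. norm (pprt (apply_bcontfun (x + y) t))
      \<le> limsup_pprt F x + limsup_pprt F y + e"
  proof eventually_elim
    case (elim t)
    have "norm (pprt (apply_bcontfun (x + y) t))
        \<le> norm (pprt (apply_bcontfun x t) + pprt (apply_bcontfun y t))"
      using pprt_add_le by (intro norm_mono_nonneg) auto
    also have "\<dots> \<le> norm (pprt (apply_bcontfun x t)) + norm (pprt (apply_bcontfun y t))"
      by (rule norm_triangle_ineq)
    finally show ?case using elim by simp
  qed
  then show "limsup_pprt F (x + y) \<le> limsup_pprt F x + limsup_pprt F y + e"
    using e limsup_pprt_nonneg[of F x] limsup_pprt_nonneg[of F y] by (intro limsup_pprt_le) auto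
next
  fix x :: "'b \<Rightarrow>\<^sub>C 'a" and c e :: real assume c: "0 < c" and e: "0 < e"
  have "\<forall>\<^sub>F t in F. norm (pprt (apply_bcontfun x t)) < limsup_pprt F x + e / c"
    using e c by (intro eventually_norm_pprt_less) auto
  then have "\<forall>\<^sub>F t in F. norm (pprt (apply_bcontfun (c *\<^sub>R x) t)) \<le> c * limsup_pprt F x + e"
    by eventually_elim (use c in \<open>simp add: pprt_scaleR field_simps\<close>)
  then show "limsup_pprt F (c *\<^sub>R x) \<le> c * limsup_pprt F x + e"
    using e c limsup_pprt_nonneg[of F x] by (intro limsup_pprt_le) auto
qed

lemma tendsto_zero_limsup_pprt:
  assumes "limsup_pprt F y \<le> 0" "limsup_pprt F (- y) \<le> 0"
  shows "(apply_bcontfun y \<longlongrightarrow> 0) F"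
proof (rule tendstoI)
  fix e :: real assume e: "0 < e"
  have "\<forall>\<^sub>F t in F. norm (pprt (apply_bcontfun y t)) < e / 2"
    "\<forall>\<^sub>F t in F. norm (pprt (- apply_bcontfun y t)) < e / 2"
    using e assms eventually_norm_pprt_less[of F y "e / 2"]
      eventually_norm_pprt_less[of F "- y" "e / 2"] by auto
  then show "\<forall>\<^sub>F t in F. dist (apply_bcontfun y t) 0 < e"
  proof eventually_elim
    case (elim t)
    have "norm (apply_bcontfun y t)
        \<le> norm (pprt (apply_bcontfun y t)) + norm (pprt (- apply_bcontfun y t))"
      using norm_triangle_ineq4 pprt_diff_pprt_uminus[of "apply_bcontfun y t"] by metis
    then show ?case using elim by simp
  qed
qed

lemma tendsto_zero_if_dominated_functionals_vanish:
  assumes vanish: "\<And>\<Phi>. linear \<Phi> \<Longrightarrow> \<Phi> \<le> limsup_pprt F \<Longrightarrow> \<Phi> y = 0"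
  shows "(apply_bcontfun y \<longlongrightarrow> 0) F"
proof (rule tendsto_zero_limsup_pprt)
  obtain \<Phi> where "linear \<Phi>" "\<Phi> \<le> limsup_pprt F" "\<Phi> y = limsup_pprt F y"
    using hahn_banach_sublinear[OF sublinear_limsup_pprt] .
  with vanish[of \<Phi>] show "limsup_pprt F y \<le> 0" by simp
next
  obtain \<Phi> where "linear \<Phi>" "\<Phi> \<le> limsup_pprt F" "\<Phi> (- y) = limsup_pprt F (- y)"
    using hahn_banach_sublinear[OF sublinear_limsup_pprt] .
  with vanish[of \<Phi>] show "limsup_pprt F (- y) \<le> 0" by (simp add: linear_neg)
qed

section \<open>The lattice of trajectories\<close>

definition bounded_by :: "real \<Rightarrow> ('t \<Rightarrow> 'v::real_normed_vector \<Rightarrow> real) \<Rightarrow> bool" where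
  "bounded_by C \<phi> \<longleftrightarrow> (\<forall>t x. \<phi> t x \<le> C * norm x)"

lemma bounded_byD: "bounded_by C \<phi> \<Longrightarrow> \<phi> t x \<le> C * norm x"
  by (simp add: bounded_by_def)

lemma le_zero_if_bounded_by_powers:
  fixes \<phi> :: "'t \<Rightarrow> 'v::real_normed_vector \<Rightarrow> real"
  assumes bound: "\<And>n. bounded_by (q ^ n * C) \<phi>" and q: "0 \<le> q" "q < 1"
  shows "\<phi> \<le> 0"
proof (intro le_funI)
  fix t and x :: 'v
  have "(\<lambda>n. q ^ n * C * norm x) \<longlonglongrightarrow> 0 * C * norm x"
    using q by (intro tendsto_intros LIMSEQ_power_zero) auto
  then show "\<phi> t x \<le> 0 t x"
    using bounded_byD[OF bound] by (auto intro: LIMSEQ_le_const)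
qed

locale eventually_positive_semigroup =
  fixes S :: "real \<Rightarrow> 'a::banach_lattice \<Rightarrow> 'a" and t0 M :: real
  assumes add: "t0 \<le> t \<Longrightarrow> S t (x + y) = S t x + S t y"
    and nonneg: "t0 \<le> t \<Longrightarrow> 0 \<le> x \<Longrightarrow> 0 \<le> S t x"
    and norm_le: "t0 \<le> t \<Longrightarrow> norm (S t x) \<le> M * norm x"
    and plus: "t0 \<le> s \<Longrightarrow> t0 \<le> t \<Longrightarrow> S (s + t) x = S s (S t x)"
    and continuous: "continuous_on {t0..} (\<lambda>t. S t x)"
    and t0_nonneg: "0 \<le> t0"
    and M_nonneg: "0 \<le> M"
begin

lemma diff: "t0 \<le> t \<Longrightarrow> S t (x - y) = S t x - S t y"
  using add[of t "x - y" y] by (simp add: algebra_simps)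

lemma mono: "t0 \<le> t \<Longrightarrow> x \<le> y \<Longrightarrow> S t x \<le> S t y"
  using nonneg[of t "y - x"] diff[of t y x] by simp

text \<open>The positive functionals of a trajectory are given by their restrictions to the positive cone;
  extending these by zero makes the pointwise order of functions the order of functionals.\<close>

definition trajectory :: "(real \<Rightarrow> 'a \<Rightarrow> real) \<Rightarrow> bool" where
  "trajectory \<phi> \<longleftrightarrow>
     (\<forall>t x. \<not> 0 \<le> x \<longrightarrow> \<phi> t x = 0) \<and>
     (\<forall>t x. 0 \<le> x \<longrightarrow> 0 \<le> \<phi> t x) \<and>
     (\<forall>t x y. 0 \<le> x \<longrightarrow> 0 \<le> y \<longrightarrow> \<phi> t (x + y) = \<phi> t x + \<phi> t y) \<and>
     (\<forall>t s x. t0 \<le> s \<longrightarrow> 0 \<le> x \<longrightarrow> \<phi> (t + s) x = \<phi> t (S s x)) \<and>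
     (\<exists>C\<ge>0. bounded_by C \<phi>)"

definition disjoint :: "(real \<Rightarrow> 'a \<Rightarrow> real) \<Rightarrow> (real \<Rightarrow> 'a \<Rightarrow> real) \<Rightarrow> bool" where
  "disjoint \<phi> \<psi> \<longleftrightarrow> (\<forall>\<theta>. trajectory \<theta> \<longrightarrow> \<theta> \<le> \<phi> \<longrightarrow> \<theta> \<le> \<psi> \<longrightarrow> \<theta> \<le> 0)"

lemma disjointD: "disjoint \<phi> \<psi> \<Longrightarrow> trajectory \<theta> \<Longrightarrow> \<theta> \<le> \<phi> \<Longrightarrow> \<theta> \<le> \<psi> \<Longrightarrow> \<theta> \<le> 0"
  by (simp add: disjoint_def)

lemma disjoint_mono: "disjoint \<phi> \<psi> \<Longrightarrow> \<phi>' \<le> \<phi> \<Longrightarrow> \<psi>' \<le> \<psi> \<Longrightarrow> disjoint \<phi>' \<psi>'"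
  unfolding disjoint_def by (meson order_trans)

lemma disjoint_sym: "disjoint \<phi> \<psi> \<Longrightarrow> disjoint \<psi> \<phi>"
  by (simp add: disjoint_def)

lemma trajectoryI:
  assumes "\<And>t x. \<not> 0 \<le> x \<Longrightarrow> \<phi> t x = 0"
    and "\<And>t x. 0 \<le> x \<Longrightarrow> 0 \<le> \<phi> t x"
    and "\<And>t x y. 0 \<le> x \<Longrightarrow> 0 \<le> y \<Longrightarrow> \<phi> t (x + y) = \<phi> t x + \<phi> t y"
    and "\<And>t s x. t0 \<le> s \<Longrightarrow> 0 \<le> x \<Longrightarrow> \<phi> (t + s) x = \<phi> t (S s x)"
    and "0 \<le> C" "bounded_by C \<phi>"
  shows "trajectory \<phi>"
  unfolding trajectory_def by (intro conjI allI impI exI[of _ C] assms)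

lemma trajectory_outside_cone: "trajectory \<phi> \<Longrightarrow> \<not> 0 \<le> x \<Longrightarrow> \<phi> t x = 0"
  by (simp add: trajectory_def)

lemma trajectory_nonneg: "trajectory \<phi> \<Longrightarrow> 0 \<le> \<phi> t x"
  by (cases "0 \<le> x") (simp_all add: trajectory_def)

lemma
  assumes "trajectory \<phi>" "0 \<le> x"
  shows trajectory_add: "0 \<le> y \<Longrightarrow> \<phi> t (x + y) = \<phi> t x + \<phi> t y"
    and trajectory_flow: "t0 \<le> s \<Longrightarrow> \<phi> (t + s) x = \<phi> t (S s x)"
  using assms by (simp_all add: trajectory_def)

lemmas trajectory_laws = trajectory_outside_cone trajectory_nonneg trajectory_add trajectory_flow

lemma trajectory_back:
  assumes "trajectory \<phi>" "0 \<le> x" "t0 \<le> s"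
  shows "\<phi> (t - s) (S s x) = \<phi> t x"
  using trajectory_flow[OF assms, of "t - s"] by simp

lemma trajectory_diff:
  assumes "trajectory \<phi>" "0 \<le> x" "x \<le> y"
  shows "\<phi> t (y - x) = \<phi> t y - \<phi> t x"
  using trajectory_add[OF assms(1,2), of "y - x" t] assms(3) by simp

lemma trajectory_zero: "trajectory \<phi> \<Longrightarrow> \<phi> t 0 = 0"
  using trajectory_add[of \<phi> 0 0 t] by simp

lemma trajectory_mono: "trajectory \<phi> \<Longrightarrow> 0 \<le> x \<Longrightarrow> x \<le> y \<Longrightarrow> \<phi> t x \<le> \<phi> t y"
  using trajectory_diff[of \<phi> x y t] trajectory_nonneg[of \<phi> t "y - x"] by simp

lemma trajectory_leI:
  assumes "trajectory \<phi>" "trajectory \<psi>" "\<And>t x. 0 \<le> x \<Longrightarrow> \<phi> t x \<le> \<psi> t x"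
  shows "\<phi> \<le> \<psi>"
proof (intro le_funI)
  show "\<phi> t x \<le> \<psi> t x" for t x
    using assms by (cases "0 \<le> x") (simp_all add: trajectory_outside_cone)
qed

lemma trajectory_bound:
  assumes "trajectory \<phi>"
  obtains C where "0 \<le> C" "bounded_by C \<phi>"
  using assms by (auto simp: trajectory_def)

lemma trajectory_diff_le:
  assumes \<phi>: "trajectory \<phi>" and "0 \<le> x" "0 \<le> y" and C: "0 \<le> C" "bounded_by C \<phi>"
  shows "\<phi> t x - \<phi> t y \<le> C * norm (x - y)"
proof -
  have "x - y \<le> pprt (x - y)" unfolding pprt_def by (rule sup_ge1)
  then have "\<phi> t x \<le> \<phi> t (y + pprt (x - y))"
    using assms(2) by (intro trajectory_mono[OF \<phi>]) (simp_all add: algebra_simps)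
  also have "\<dots> = \<phi> t y + \<phi> t (pprt (x - y))"
    using assms(3) by (intro trajectory_add[OF \<phi>]) auto
  also have "\<phi> t (pprt (x - y)) \<le> C * norm (pprt (x - y))" by (rule bounded_byD[OF C(2)])
  also have "\<dots> \<le> C * norm (x - y)" by (intro mult_left_mono norm_pprt_le C)
  finally show ?thesis by simp
qed

lemma trajectory_scale:
  assumes "trajectory \<phi>" "0 \<le> c"
  shows "trajectory (\<lambda>t x. c * \<phi> t x)"
proof -
  obtain C where C: "0 \<le> C" "bounded_by C \<phi>"
    using trajectory_bound[OF assms(1)] .
  have bounded: "bounded_by (c * C) (\<lambda>t x. c * \<phi> t x)"
    using C(2) assms(2) by (simp add: bounded_by_def mult_left_mono mult.assoc)
  show ?thesis
    by (rule trajectoryI[OF _ _ _ _ mult_nonneg_nonneg[OF assms(2) C(1)] bounded])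
      (simp_all add: assms(2) trajectory_laws[OF assms(1)] distrib_left)
qed

lemma trajectory_plus:
  assumes \<phi>: "trajectory \<phi>" and \<psi>: "trajectory \<psi>"
  shows "trajectory (\<phi> + \<psi>)"
proof -
  obtain C where C: "0 \<le> C" "bounded_by C \<phi>"
    using trajectory_bound[OF \<phi>] .
  obtain D where D: "0 \<le> D" "bounded_by D \<psi>"
    using trajectory_bound[OF \<psi>] .
  have bounded: "bounded_by (C + D) (\<phi> + \<psi>)"
    using C(2) D(2) by (simp add: bounded_by_def distrib_right add_mono)
  show ?thesis
    by (rule trajectoryI[OF _ _ _ _ add_nonneg_nonneg[OF C(1) D(1)] bounded])
      (simp_all add: trajectory_laws[OF \<phi>] trajectory_laws[OF \<psi>])
qed

lemma trajectory_minus: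
  assumes \<phi>: "trajectory \<phi>" and \<psi>: "trajectory \<psi>" and le: "\<psi> \<le> \<phi>"
  shows "trajectory (\<phi> - \<psi>)"
proof -
  obtain C where C: "0 \<le> C" "bounded_by C \<phi>"
    using trajectory_bound[OF \<phi>] .
  have "(\<phi> - \<psi>) t x \<le> C * norm x" for t x
    using bounded_byD[OF C(2), of t x] trajectory_nonneg[OF \<psi>, of t x] by simp
  then have bounded: "bounded_by C (\<phi> - \<psi>)" by (simp add: bounded_by_def del: minus_apply)
  show ?thesis
    by (rule trajectoryI[OF _ _ _ _ C(1) bounded])
      (use le in \<open>simp_all add: le_fun_def trajectory_laws[OF \<phi>] trajectory_laws[OF \<psi>]\<close>)
qed

lemma trajectory_shift:
  assumes "trajectory \<phi>"
  shows "trajectory (\<lambda>t. \<phi> (t + h))"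
proof -
  obtain C where C: "0 \<le> C" "bounded_by C \<phi>"
    using trajectory_bound[OF assms] .
  show ?thesis
  proof (rule trajectoryI[OF _ _ _ _ C(1)])
    show "\<phi> (t + s + h) x = \<phi> (t + h) (S s x)" if "t0 \<le> s" "0 \<le> x" for t s x
      using trajectory_flow[OF assms that(2,1), of "t + h"] by (simp add: ac_simps)
    show "bounded_by C (\<lambda>t. \<phi> (t + h))"
      using C(2) by (simp add: bounded_by_def)
  qed (simp_all add: trajectory_laws[OF assms])
qed

definition split_value ::
  "(real \<Rightarrow> 'a \<Rightarrow> real) \<Rightarrow> (real \<Rightarrow> 'a \<Rightarrow> real) \<Rightarrow> real \<Rightarrow> 'a \<Rightarrow> real \<Rightarrow> 'a \<Rightarrow> real" where
  "split_value \<phi> \<psi> t x s y = \<phi> (t - s) y + \<psi> (t - s) (S s x - y)"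

definition split_values ::
  "(real \<Rightarrow> 'a \<Rightarrow> real) \<Rightarrow> (real \<Rightarrow> 'a \<Rightarrow> real) \<Rightarrow> real \<Rightarrow> 'a \<Rightarrow> real set" where
  "split_values \<phi> \<psi> t x = {split_value \<phi> \<psi> t x s y | s y. t0 \<le> s \<and> 0 \<le> y \<and> y \<le> S s x}"

text \<open>The Riesz-Kantorovich meet of \<open>\<phi> (t - s)\<close> and \<open>\<psi> (t - s)\<close>, pulled back along \<open>S s\<close>,
  decreases in \<open>s\<close>; the meet of the trajectories is its infimum over \<open>s\<close>.\<close>

definition meet :: "(real \<Rightarrow> 'a \<Rightarrow> real) \<Rightarrow> (real \<Rightarrow> 'a \<Rightarrow> real) \<Rightarrow> real \<Rightarrow> 'a \<Rightarrow> real" where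
  "meet \<phi> \<psi> t x = (if 0 \<le> x then Inf (split_values \<phi> \<psi> t x) else 0)"

context
  fixes \<phi> \<psi>
  assumes \<phi>: "trajectory \<phi>" and \<psi>: "trajectory \<psi>"
begin

lemma split_value_nonneg: "0 \<le> split_value \<phi> \<psi> t x s y"
  unfolding split_value_def by (intro add_nonneg_nonneg trajectory_nonneg \<phi> \<psi>)

lemma split_value_add:
  assumes "t0 \<le> s" "0 \<le> y1" "y1 \<le> S s x1" "0 \<le> y2" "y2 \<le> S s x2"
  shows "split_value \<phi> \<psi> t (x1 + x2) s (y1 + y2)
    = split_value \<phi> \<psi> t x1 s y1 + split_value \<phi> \<psi> t x2 s y2"
proof -
  have split: "S s (x1 + x2) - (y1 + y2) = (S s x1 - y1) + (S s x2 - y2)"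
    using assms(1) by (simp add: add algebra_simps)
  show ?thesis
    unfolding split_value_def split
    using assms by (simp add: trajectory_add[OF \<phi>] trajectory_add[OF \<psi>])
qed

lemma split_value_push:
  assumes "t0 \<le> r" "t0 \<le> s" "0 \<le> y" "y \<le> S s x"
  shows "split_value \<phi> \<psi> t x (r + s) (S r y) = split_value \<phi> \<psi> t x s y"
proof -
  have push: "S (r + s) x - S r y = S r (S s x - y)" "t - (r + s) = t - s - r"
    using assms by (simp_all add: plus diff)
  show ?thesis
    unfolding split_value_def push using assms
    by (simp add: trajectory_back[OF \<phi>] trajectory_back[OF \<psi>])
qed

lemma split_value_flow:
  assumes "t0 \<le> r" "t0 \<le> s"
  shows "split_value \<phi> \<psi> (t + r) x (s + r) y = split_value \<phi> \<psi> t (S r x) s y"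
  using assms by (simp add: split_value_def plus)

lemma meet_le:
  assumes "0 \<le> x" "t0 \<le> s" "0 \<le> y" "y \<le> S s x"
  shows "meet \<phi> \<psi> t x \<le> split_value \<phi> \<psi> t x s y"
proof -
  have "bdd_below (split_values \<phi> \<psi> t x)"
    by (rule bdd_belowI[of _ 0]) (auto simp: split_values_def split_value_nonneg)
  moreover have "split_value \<phi> \<psi> t x s y \<in> split_values \<phi> \<psi> t x"
    using assms by (auto simp: split_values_def)
  ultimately show ?thesis using assms by (simp add: meet_def cInf_lower)
qed

lemma split_values_nonempty: "0 \<le> x \<Longrightarrow> split_values \<phi> \<psi> t x \<noteq> {}"
  unfolding split_values_def using nonneg[of t0 x] by blast

lemma le_meet:
  assumes "0 \<le> x" "\<And>s y. t0 \<le> s \<Longrightarrow> 0 \<le> y \<Longrightarrow> y \<le> S s x \<Longrightarrow> c \<le> split_value \<phi> \<psi> t x s y"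
  shows "c \<le> meet \<phi> \<psi> t x"
proof -
  have "c \<le> Inf (split_values \<phi> \<psi> t x)"
    by (rule cInf_greatest[OF split_values_nonempty[OF assms(1)]])
      (use assms(2) in \<open>auto simp: split_values_def\<close>)
  then show ?thesis using assms(1) by (simp add: meet_def)
qed

lemma meet_approx:
  assumes "0 \<le> x" "meet \<phi> \<psi> t x < c"
  obtains s y where "t0 \<le> s" "0 \<le> y" "y \<le> S s x" "split_value \<phi> \<psi> t x s y < c"
proof -
  have "Inf (split_values \<phi> \<psi> t x) < c" using assms by (simp add: meet_def)
  from cInf_lessD[OF split_values_nonempty[OF assms(1)] this] that show thesis
    by (auto simp: split_values_def)
qed

lemma meet_nonneg: "0 \<le> meet \<phi> \<psi> t x"
proof (cases "0 \<le> x")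
  case True
  then show ?thesis by (rule le_meet) (rule split_value_nonneg)
qed (simp add: meet_def)

lemma meet_le1: "meet \<phi> \<psi> \<le> \<phi>"
proof (intro le_funI)
  fix t x
  show "meet \<phi> \<psi> t x \<le> \<phi> t x"
  proof (cases "0 \<le> x")
    case True
    then have "meet \<phi> \<psi> t x \<le> split_value \<phi> \<psi> t x t0 (S t0 x)"
      by (intro meet_le) (auto simp: nonneg)
    also have "\<dots> = \<phi> t x"
      using True by (simp add: split_value_def trajectory_zero[OF \<psi>] trajectory_back[OF \<phi>])
    finally show ?thesis .
  qed (simp add: meet_def trajectory_outside_cone[OF \<phi>])
qed

lemma meet_le2: "meet \<phi> \<psi> \<le> \<psi>"
proof (intro le_funI)
  fix t x
  show "meet \<phi> \<psi> t x \<le> \<psi> t x"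
  proof (cases "0 \<le> x")
    case True
    then have "meet \<phi> \<psi> t x \<le> split_value \<phi> \<psi> t x t0 0"
      by (intro meet_le) (auto simp: nonneg)
    also have "\<dots> = \<psi> t x"
      using True by (simp add: split_value_def trajectory_zero[OF \<phi>] trajectory_back[OF \<psi>])
    finally show ?thesis .
  qed (simp add: meet_def trajectory_outside_cone[OF \<psi>])
qed

lemma meet_superadditive:
  assumes "0 \<le> x1" "0 \<le> x2"
  shows "meet \<phi> \<psi> t x1 + meet \<phi> \<psi> t x2 \<le> meet \<phi> \<psi> t (x1 + x2)"
proof (rule le_meet)
  fix s y assume s: "t0 \<le> s" and "0 \<le> y" "y \<le> S s (x1 + x2)"
  then obtain y1 y2 where y: "y = y1 + y2" "0 \<le> y1" "y1 \<le> S s x1" "0 \<le> y2" "y2 \<le> S s x2"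
    using riesz_decomposition[of y "S s x1" "S s x2"] assms by (auto simp: add nonneg)
  then have "meet \<phi> \<psi> t x1 + meet \<phi> \<psi> t x2 \<le> split_value \<phi> \<psi> t x1 s y1 + split_value \<phi> \<psi> t x2 s y2"
    using assms s by (intro add_mono meet_le)
  also have "\<dots> = split_value \<phi> \<psi> t (x1 + x2) s y"
    unfolding y(1) by (rule split_value_add[OF s y(2-5), symmetric])
  finally show "meet \<phi> \<psi> t x1 + meet \<phi> \<psi> t x2 \<le> split_value \<phi> \<psi> t (x1 + x2) s y" .
qed (use assms in simp)

lemma meet_subadditive:
  assumes x: "0 \<le> x1" "0 \<le> x2"
  shows "meet \<phi> \<psi> t (x1 + x2) \<le> meet \<phi> \<psi> t x1 + meet \<phi> \<psi> t x2"
proof (rule field_le_epsilon)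
  fix e :: real assume "0 < e"
  then have "meet \<phi> \<psi> t x1 < meet \<phi> \<psi> t x1 + e / 2" "meet \<phi> \<psi> t x2 < meet \<phi> \<psi> t x2 + e / 2"
    by simp_all
  then obtain s1 y1 s2 y2
    where y1: "t0 \<le> s1" "0 \<le> y1" "y1 \<le> S s1 x1" "split_value \<phi> \<psi> t x1 s1 y1 < meet \<phi> \<psi> t x1 + e / 2"
      and y2: "t0 \<le> s2" "0 \<le> y2" "y2 \<le> S s2 x2" "split_value \<phi> \<psi> t x2 s2 y2 < meet \<phi> \<psi> t x2 + e / 2"
    using x by (elim meet_approx[rotated])
  have pushed: "0 \<le> S s2 y1" "S s2 y1 \<le> S (s2 + s1) x1" "0 \<le> S s1 y2" "S s1 y2 \<le> S (s2 + s1) x2"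
    using y1 y2 plus[OF y2(1) y1(1), of x1] plus[OF y1(1) y2(1), of x2]
    by (simp_all add: nonneg mono add.commute[of s2 s1])
  have s: "t0 \<le> s2 + s1" using y1(1) y2(1) t0_nonneg by simp
  have "meet \<phi> \<psi> t (x1 + x2) \<le> split_value \<phi> \<psi> t (x1 + x2) (s2 + s1) (S s2 y1 + S s1 y2)"
    using x s pushed by (intro meet_le) (auto simp: add intro: add_mono)
  also have "\<dots> = split_value \<phi> \<psi> t x1 (s2 + s1) (S s2 y1)
      + split_value \<phi> \<psi> t x2 (s2 + s1) (S s1 y2)"
    by (rule split_value_add[OF s pushed])
  also have "\<dots> = split_value \<phi> \<psi> t x1 s1 y1 + split_value \<phi> \<psi> t x2 s2 y2"
    using split_value_push[OF y2(1) y1(1-3)] split_value_push[OF y1(1) y2(1-3)]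
    by (simp add: add.commute)
  finally show "meet \<phi> \<psi> t (x1 + x2) \<le> meet \<phi> \<psi> t x1 + meet \<phi> \<psi> t x2 + e"
    using y1(4) y2(4) by simp
qed

lemma meet_flow:
  assumes r: "t0 \<le> r" and x: "0 \<le> x"
  shows "meet \<phi> \<psi> (t + r) x = meet \<phi> \<psi> t (S r x)"
proof (rule antisym)
  show "meet \<phi> \<psi> (t + r) x \<le> meet \<phi> \<psi> t (S r x)"
  proof (rule le_meet)
    fix s y assume s: "t0 \<le> s" and y: "0 \<le> y" "y \<le> S s (S r x)"
    then have "meet \<phi> \<psi> (t + r) x \<le> split_value \<phi> \<psi> (t + r) x (s + r) y"
      using r x t0_nonneg by (intro meet_le) (auto simp: plus)
    then show "meet \<phi> \<psi> (t + r) x \<le> split_value \<phi> \<psi> t (S r x) s y"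
      by (simp add: split_value_flow[OF r s])
  qed (use r x nonneg in auto)
  show "meet \<phi> \<psi> t (S r x) \<le> meet \<phi> \<psi> (t + r) x"
  proof (rule le_meet[OF x])
    fix s y assume s: "t0 \<le> s" and y: "0 \<le> y" "y \<le> S s x"
    have "S s (S r x) = S r (S s x)"
      using plus[OF r s] plus[OF s r] by (simp add: add.commute)
    then have "meet \<phi> \<psi> t (S r x) \<le> split_value \<phi> \<psi> t (S r x) s (S r y)"
      using r s x y by (intro meet_le) (auto simp: nonneg mono)
    also have "\<dots> = split_value \<phi> \<psi> (t + r) x (s + r) (S r y)"
      by (rule split_value_flow[OF r s, symmetric])
    also have "\<dots> = split_value \<phi> \<psi> (t + r) x s y"
      using split_value_push[OF r s y] by (simp add: add.commute)
    finally show "meet \<phi> \<psi> t (S r x) \<le> split_value \<phi> \<psi> (t + r) x s y" .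
  qed
qed

lemma trajectory_meet: "trajectory (meet \<phi> \<psi>)"
proof -
  obtain C where C: "0 \<le> C" "bounded_by C \<phi>"
    using trajectory_bound[OF \<phi>] .
  show ?thesis
  proof (rule trajectoryI[OF _ _ _ _ C(1)])
    have "meet \<phi> \<psi> t x \<le> C * norm x" for t x
      using le_funD[OF le_funD[OF meet_le1]] bounded_byD[OF C(2)] by (rule order_trans)
    then show "bounded_by C (meet \<phi> \<psi>)" by (simp add: bounded_by_def)
    show "meet \<phi> \<psi> t (x + y) = meet \<phi> \<psi> t x + meet \<phi> \<psi> t y" if "0 \<le> x" "0 \<le> y" for t x y
      using meet_subadditive[OF that] meet_superadditive[OF that] by (rule antisym)
    show "meet \<phi> \<psi> t x = 0" if "\<not> 0 \<le> x" for t x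
      using that by (simp add: meet_def)
  qed (rule meet_nonneg meet_flow; assumption?)+
qed

lemma le_meet_plus:
  assumes \<theta>: "trajectory \<theta>" and \<beta>: "trajectory \<beta>" and le: "\<theta> \<le> \<phi> + \<beta>" "\<theta> \<le> \<psi> + \<beta>"
  shows "\<theta> \<le> meet \<phi> \<psi> + \<beta>"
proof (rule trajectory_leI[OF \<theta> trajectory_plus[OF trajectory_meet \<beta>]])
  fix t and x :: 'a assume x: "0 \<le> x"
  have "\<theta> t x - \<beta> t x \<le> meet \<phi> \<psi> t x"
  proof (rule le_meet[OF x])
    fix s y assume s: "t0 \<le> s" and y: "0 \<le> y" "y \<le> S s x"
    let ?r = "t - s"
    have "\<theta> ?r y \<le> \<phi> ?r y + \<beta> ?r y" "\<theta> ?r (S s x - y) \<le> \<psi> ?r (S s x - y) + \<beta> ?r (S s x - y)"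
      using le by (auto simp: le_fun_def)
    then show "\<theta> t x - \<beta> t x \<le> split_value \<phi> \<psi> t x s y"
      using trajectory_back[OF \<theta> x s, of t] trajectory_back[OF \<beta> x s, of t]
        trajectory_diff[OF \<theta> y, of ?r] trajectory_diff[OF \<beta> y, of ?r]
      unfolding split_value_def by linarith
  qed
  then show "\<theta> t x \<le> (meet \<phi> \<psi> + \<beta>) t x" by simp
qed

lemma disjoint_meet_residues: "disjoint (\<phi> - meet \<phi> \<psi>) (\<psi> - meet \<phi> \<psi>)"
  unfolding disjoint_def
proof (intro allI impI)
  fix \<theta> assume \<theta>: "trajectory \<theta>" "\<theta> \<le> \<phi> - meet \<phi> \<psi>" "\<theta> \<le> \<psi> - meet \<phi> \<psi>"
  have zero: "trajectory 0" using trajectory_scale[OF \<phi>, of 0] by (simp add: zero_fun_def)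
  have "\<theta> + meet \<phi> \<psi> \<le> meet \<phi> \<psi> + 0"
    using \<theta> by (intro le_meet_plus trajectory_plus trajectory_meet zero) (simp_all add: le_diff_eq)
  then show "\<theta> \<le> 0" by simp
qed

lemma meet_disjoint: "disjoint \<phi> \<psi> \<Longrightarrow> meet \<phi> \<psi> \<le> 0"
  by (rule disjointD[OF _ trajectory_meet meet_le1 meet_le2])

lemma disjoint_bound:
  assumes disj: "disjoint \<phi> \<psi>" and D: "0 \<le> D" "bounded_by D (\<phi> - \<psi>)"
  shows "bounded_by (M * D) \<phi>"
proof -
  have approx: "\<phi> t x \<le> M * D * norm x + e" if x: "0 \<le> x" and e: "0 < e" for t x e
  proof -
    have "meet \<phi> \<psi> t x \<le> 0"
      using meet_disjoint[OF disj] by (simp add: le_fun_def)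
    with e have "meet \<phi> \<psi> t x < e" by linarith
    then obtain s y where s: "t0 \<le> s" and y: "0 \<le> y" "y \<le> S s x"
      and small: "split_value \<phi> \<psi> t x s y < e"
      using meet_approx[OF x] by blast
    let ?r = "t - s" and ?z = "S s x - y"
    have "\<phi> t x = \<phi> ?r y + \<phi> ?r ?z"
      using trajectory_back[OF \<phi> x s, of t] trajectory_diff[OF \<phi> y, of ?r] by simp
    also have "\<phi> ?r ?z \<le> \<psi> ?r ?z + D * norm ?z"
      using bounded_byD[OF D(2), of ?r ?z] by simp
    also have "D * norm ?z \<le> D * norm (S s x)"
      using y by (intro mult_left_mono D norm_mono_nonneg) auto
    also have "\<dots> \<le> D * (M * norm x)" by (intro mult_left_mono D norm_le s)
    finally show ?thesis
      using small by (simp add: split_value_def algebra_simps)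
  qed
  show ?thesis
    unfolding bounded_by_def
  proof (intro allI)
    show "\<phi> t x \<le> M * D * norm x" for t x
    proof (cases "0 \<le> x")
      case True
      then show ?thesis by (rule field_le_epsilon[OF approx])
    qed (use D(1) M_nonneg in \<open>simp add: trajectory_outside_cone[OF \<phi>]\<close>)
  qed
qed

end

lemma le_of_le_plus_disjoint:
  assumes \<phi>: "trajectory \<phi>" and \<alpha>: "trajectory \<alpha>" and \<beta>: "trajectory \<beta>"
    and le: "\<phi> \<le> \<alpha> + \<beta>" and disj: "disjoint \<phi> \<alpha>"
  shows "\<phi> \<le> \<beta>"
proof -
  have "\<phi> \<le> \<phi> + \<beta>"
    using trajectory_nonneg[OF \<beta>] by (simp add: le_fun_def)
  then have "\<phi> \<le> meet \<phi> \<alpha> + \<beta>" by (rule le_meet_plus[OF \<phi> \<alpha> \<phi> \<beta> _ le])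
  also have "\<dots> \<le> 0 + \<beta>" by (intro add_right_mono meet_disjoint[OF \<phi> \<alpha> disj])
  finally show ?thesis by simp
qed

lemma disjoint_scale:
  assumes disj: "disjoint \<phi> \<psi>" and \<phi>: "trajectory \<phi>" and c: "1 \<le> c"
  shows "disjoint (\<lambda>t x. c * \<phi> t x) \<psi>"
  unfolding disjoint_def
proof (intro allI impI)
  fix \<theta> assume \<theta>: "trajectory \<theta>" "\<theta> \<le> (\<lambda>t x. c * \<phi> t x)" "\<theta> \<le> \<psi>"
  have "(\<lambda>t x. (1 / c) * \<theta> t x) \<le> 0"
  proof (rule disjointD[OF disj])
    show "trajectory (\<lambda>t x. (1 / c) * \<theta> t x)" using c by (intro trajectory_scale \<theta>) auto
    show "(\<lambda>t x. (1 / c) * \<theta> t x) \<le> \<phi>"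
      using \<theta>(2) c by (simp add: le_fun_def field_simps)
    have "(1 / c) * \<theta> t x \<le> \<theta> t x" for t x
      using c trajectory_nonneg[OF \<theta>(1), of t x] mult_right_mono[of "1 / c" 1 "\<theta> t x"] by simp
    then show "(\<lambda>t x. (1 / c) * \<theta> t x) \<le> \<psi>"
      using \<theta>(3) unfolding le_fun_def by (meson order_trans)
  qed
  then show "\<theta> \<le> 0"
    using c by (simp add: le_fun_def divide_le_0_iff)
qed

section \<open>Small shifts fix every trajectory\<close>

context
  fixes h t1 \<epsilon> :: real
  assumes step: "\<And>t x. t1 \<le> t \<Longrightarrow> norm (S (t + h) x - S t x) \<le> \<epsilon> * norm x"
    and \<epsilon>: "0 \<le> \<epsilon>" "M * \<epsilon> < 1"
begin

lemma bounded_by_minus_shift: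
  assumes \<phi>: "trajectory \<phi>" and C: "0 \<le> C" "bounded_by C \<phi>"
  shows "bounded_by (C * \<epsilon>) (\<phi> - (\<lambda>t. \<phi> (t + h)))"
proof -
  define s where "s = max t1 (max t0 (t0 - h))"
  have s: "t0 \<le> s" "t0 \<le> s + h" "t1 \<le> s" by (auto simp: s_def)
  have "\<phi> t x - \<phi> (t + h) x \<le> C * \<epsilon> * norm x" if x: "0 \<le> x" for t x
  proof -
    have "\<phi> t x = \<phi> (t - s) (S s x)" "\<phi> (t + h) x = \<phi> (t - s) (S (s + h) x)"
      using trajectory_back[OF \<phi> x s(1)] trajectory_back[OF \<phi> x s(2), of "t + h"] by simp_all
    then have "\<phi> t x - \<phi> (t + h) x \<le> C * norm (S s x - S (s + h) x)"
      using trajectory_diff_le[OF \<phi> _ _ C] s x by (simp add: nonneg)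
    also have "\<dots> \<le> C * (\<epsilon> * norm x)"
      using step[OF s(3), of x] C by (intro mult_left_mono) (simp_all add: norm_minus_commute)
    finally show ?thesis by (simp add: mult.assoc)
  qed
  moreover have "\<phi> t x - \<phi> (t + h) x \<le> C * \<epsilon> * norm x" if "\<not> 0 \<le> x" for t x
    using that C(1) \<epsilon>(1) by (simp add: trajectory_outside_cone[OF \<phi>])
  ultimately have "\<phi> t x - \<phi> (t + h) x \<le> C * \<epsilon> * norm x" for t x
    by (cases "0 \<le> x")
  then show ?thesis by (simp add: bounded_by_def)
qed

text \<open>A common lower bound \<open>u\<close> is disjoint from its own shift, yet close to it, so every bound of
  \<open>u\<close> improves by the factor \<open>M * \<epsilon>\<close>.\<close>

lemma disjoint_shift_back:
  assumes disj: "disjoint \<phi> \<psi>"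
  shows "disjoint (\<lambda>t. \<phi> (t - h)) \<psi>"
  unfolding disjoint_def
proof (intro allI impI)
  fix u assume u: "trajectory u" and le: "u \<le> (\<lambda>t. \<phi> (t - h))" "u \<le> \<psi>"
  have shift: "trajectory (\<lambda>t. u (t + h))" by (rule trajectory_shift[OF u])
  have "(\<lambda>t. u (t + h)) \<le> \<phi>"
  proof (rule le_funI)
    show "u (t + h) \<le> \<phi> t" for t
      using le_funD[OF le(1), of "t + h"] by simp
  qed
  then have disj_shift: "disjoint u (\<lambda>t. u (t + h))"
    using le(2) by (rule disjoint_sym[OF disjoint_mono[OF disj]])
  obtain C where C: "0 \<le> C" "bounded_by C u"
    using trajectory_bound[OF u] .
  have "bounded_by ((M * \<epsilon>) ^ n * C) u" for n
  proof (induction n)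
    case (Suc n)
    have nonneg: "0 \<le> (M * \<epsilon>) ^ n * C" using M_nonneg \<epsilon>(1) C(1) by simp
    have "bounded_by (M * ((M * \<epsilon>) ^ n * C * \<epsilon>)) u"
      using nonneg \<epsilon>(1) bounded_by_minus_shift[OF u nonneg Suc.IH]
      by (intro disjoint_bound[OF u shift disj_shift]) auto
    then show ?case by (simp add: algebra_simps)
  qed (use C in simp)
  then show "u \<le> 0"
    using M_nonneg \<epsilon> by (intro le_zero_if_bounded_by_powers) auto
qed

lemma disjoint_iterated_shift_back:
  assumes "disjoint \<phi> \<psi>"
  shows "disjoint (\<lambda>t. \<phi> (t - real n * h)) \<psi>"
proof (induction n)
  case (Suc n)
  show ?case using disjoint_shift_back[OF Suc] by (simp add: algebra_simps)
qed (use assms in simp)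

text \<open>With \<open>V\<close> the shift by \<open>h\<close>, \<open>p = (V f - c f)\<^sup>+\<close> and \<open>q = (V f - c f)\<^sup>-\<close>, the bound
  \<open>c\<^sup>n V\<^sup>-\<^sup>n p \<le> V f\<close> propagates in \<open>n\<close>: applying \<open>V\<^sup>-\<^sup>1\<close> and multiplying by \<open>c\<close> gives
  \<open>c\<^sup>n\<^sup>+\<^sup>1 V\<^sup>-\<^sup>n\<^sup>-\<^sup>1 p \<le> c f \<le> q + V f\<close>, where the left-hand side is disjoint from \<open>q\<close>.\<close>

lemma scaled_shifts_back_le:
  assumes f: "trajectory f" and p: "trajectory p" and q: "trajectory q"
    and disj: "disjoint p q" and c: "1 \<le> c"
    and p_le: "p \<le> (\<lambda>t. f (t + h))" and f_le: "(\<lambda>t x. c * f t x) \<le> q + (\<lambda>t. f (t + h))"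
  shows "(\<lambda>t x. c ^ n * p (t - real n * h) x) \<le> (\<lambda>t. f (t + h))"
proof (induction n)
  case (Suc n)
  let ?p = "\<lambda>t x. c ^ Suc n * p (t - real (Suc n) * h) x"
  have shift: "trajectory (\<lambda>t. p (t - real (Suc n) * h))"
    using trajectory_shift[OF p, of "- (real (Suc n) * h)"] by simp
  have "c ^ n * p (t - real (Suc n) * h) x \<le> f t x" for t x
    using le_funD[OF le_funD[OF Suc, of "t - h"], of x] by (simp add: algebra_simps)
  then have "?p t x \<le> c * f t x" for t x
    using c by (simp add: mult.assoc mult_left_mono)
  then have "?p \<le> (\<lambda>t x. c * f t x)" by (intro le_funI)
  then have "?p \<le> q + (\<lambda>t. f (t + h))" using f_le by (rule order_trans)
  moreover have "disjoint ?p q"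
    using disjoint_iterated_shift_back[OF disj] shift one_le_power[OF c] by (rule disjoint_scale)
  moreover have "trajectory ?p"
    using c by (intro trajectory_scale[OF shift]) simp
  ultimately show ?case
    using le_of_le_plus_disjoint[OF _ q trajectory_shift[OF f]] by blast
qed (use p_le in simp)

lemma shift_le_scale:
  assumes f: "trajectory f" and c: "1 < c"
  shows "(\<lambda>t. f (t + h)) \<le> (\<lambda>t x. c * f t x)"
proof -
  let ?g = "\<lambda>t. f (t + h)" and ?cf = "\<lambda>t x. c * f t x"
  define m where "m = meet ?g ?cf"
  have g: "trajectory ?g" by (rule trajectory_shift[OF f])
  have cf: "trajectory ?cf" using c by (intro trajectory_scale f) simp
  have m: "trajectory m" "m \<le> ?g" "m \<le> ?cf"
    unfolding m_def by (rule trajectory_meet meet_le1 meet_le2; fact g cf)+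
  obtain C where C: "0 \<le> C" "bounded_by C f"
    using trajectory_bound[OF f] .
  have back_le: "(\<lambda>t x. c ^ n * (?g - m) (t - real n * h) x) \<le> ?g" for n
  proof (rule scaled_shifts_back_le[OF f])
    show "trajectory (?g - m)" "trajectory (?cf - m)"
      by (rule trajectory_minus g cf m)+
    show "disjoint (?g - m) (?cf - m)"
      unfolding m_def by (rule disjoint_meet_residues[OF g cf])
    show "?g - m \<le> ?g" "?cf \<le> (?cf - m) + ?g"
      using trajectory_nonneg[OF m(1)] m(2) by (simp_all add: le_fun_def)
  qed (use c in simp)
  have "c ^ n * (?g - m) t x \<le> C * norm x" for n t x
  proof -
    have "c ^ n * (?g - m) t x \<le> ?g (t + real n * h) x"
      using le_funD[OF le_funD[OF back_le], of n "t + real n * h" x] by simp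
    also have "\<dots> \<le> C * norm x" by (rule bounded_byD[OF C(2)])
    finally show ?thesis .
  qed
  then have "bounded_by ((1 / c) ^ n * C) (?g - m)" for n
    unfolding bounded_by_def
    using c by (simp only: power_one_over) (simp add: pos_le_divide_eq mult.commute)
  then have "?g - m \<le> 0"
    using c by (intro le_zero_if_bounded_by_powers) auto
  then show ?thesis using m(3) by simp
qed

lemma shift_le:
  assumes f: "trajectory f"
  shows "f (t + h) x \<le> f t x"
proof (rule field_le_mult_one_interval)
  fix z :: real assume z: "0 < z" "z < 1"
  then have "f (t + h) x \<le> (1 / z) * f t x"
    using shift_le_scale[OF f, of "1 / z"] by (simp add: le_fun_def)
  then show "z * f (t + h) x \<le> f t x" using z by (simp add: field_simps)
qed

end

context
  fixes t1 \<delta> \<epsilon> :: real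
  assumes step: "\<And>s t x. 0 \<le> s \<Longrightarrow> s < \<delta> \<Longrightarrow> t1 \<le> t \<Longrightarrow> norm (S (t + s) x - S t x) \<le> \<epsilon> * norm x"
    and \<epsilon>: "0 \<le> \<epsilon>" "M * \<epsilon> < 1"
    and \<delta>: "0 < \<delta>"
begin

lemma small_shift_eq:
  assumes f: "trajectory f" and h: "0 \<le> h" "h < \<delta>"
  shows "f (t + h) x = f t x"
proof (rule antisym)
  show "f (t + h) x \<le> f t x"
    using step[OF h] by (intro shift_le[OF _ \<epsilon> f])
  have step_back: "norm (S (s + - h) y - S s y) \<le> \<epsilon> * norm y" if "t1 + h \<le> s" for s y
    using step[OF h, of "s - h" y] that by (simp add: norm_minus_commute)
  have "f (t + h + - h) x \<le> f (t + h) x"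
    by (rule shift_le[OF step_back \<epsilon> f])
  then show "f t x \<le> f (t + h) x" by simp
qed

lemma trajectory_constant:
  assumes f: "trajectory f" and s: "0 \<le> s"
  shows "f (t + s) x = f t x"
proof -
  obtain n :: nat where n: "s / \<delta> < real n" using reals_Archimedean2 by blast
  moreover have "0 \<le> s / \<delta>" using s \<delta> by simp
  ultimately have "0 < real n" by linarith
  then have h: "0 \<le> s / real n" "s / real n < \<delta>" "real n * (s / real n) = s"
    using s n \<delta> by (simp_all add: field_simps)
  have "f (t + real k * (s / real n)) x = f t x" for k
  proof (induction k)
    case (Suc k)
    then show ?case
      using small_shift_eq[OF f h(1,2), of "t + real k * (s / real n)" x]
      by (simp add: algebra_simps add_divide_distrib)
  qed simp
  from this[of n] show ?thesis by (simp only: h(3))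
qed

end

section \<open>Trajectories from functionals on orbits\<close>

definition orbit :: "real \<Rightarrow> 'a \<Rightarrow> real \<Rightarrow>\<^sub>C 'a" where
  "orbit r x = Bcontfun (\<lambda>t. S (max t0 (t + r)) x)"

lemma apply_orbit [simp]: "apply_bcontfun (orbit r x) t = S (max t0 (t + r)) x"
proof -
  have "continuous_on UNIV (\<lambda>t. S (max t0 (t + r)) x)"
    by (rule continuous_on_compose2[OF continuous]) (auto intro!: continuous_intros)
  then have "(\<lambda>t. S (max t0 (t + r)) x) \<in> bcontfun"
    by (rule bcontfun_normI[OF _ norm_le]) simp
  then show ?thesis by (simp add: orbit_def Bcontfun_inverse)
qed

lemma orbit_add: "orbit r (x + y) = orbit r x + orbit r y"
  by (rule bcontfun_eqI) (simp add: add)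

lemma limsup_pprt_orbit_diff:
  assumes "t0 \<le> s"
  shows "limsup_pprt at_top (orbit (r + s) x - orbit r (S s x)) \<le> 0"
    and "limsup_pprt at_top (orbit r (S s x) - orbit (r + s) x) \<le> 0"
proof -
  have "\<forall>\<^sub>F t in at_top. S (max t0 (t + (r + s))) x = S (max t0 (t + r)) (S s x)"
    using eventually_ge_at_top[of "t0 - r"]
  proof eventually_elim
    case (elim t)
    then have "S (t + r + s) x = S (t + r) (S s x)" using assms by (intro plus) auto
    then show ?case using elim assms t0_nonneg by (simp add: max_def add.assoc)
  qed
  then show "limsup_pprt at_top (orbit (r + s) x - orbit r (S s x)) \<le> 0"
    "limsup_pprt at_top (orbit r (S s x) - orbit (r + s) x) \<le> 0"
    by (auto intro!: limsup_pprt_le elim!: eventually_mono)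
qed

lemma trajectory_functional:
  assumes linear: "linear \<Phi>" and dominated: "\<Phi> \<le> limsup_pprt at_top"
  shows "trajectory (\<lambda>r x. if 0 \<le> x then \<Phi> (orbit r x) else 0)"
proof -
  have dom: "\<Phi> y \<le> c" if "limsup_pprt at_top y \<le> c" for y c
    using le_funD[OF dominated, of y] that by (rule order_trans)
  show ?thesis
  proof (rule trajectoryI[OF _ _ _ _ M_nonneg])
    fix r and x :: 'a assume x: "0 \<le> x"
    then have "\<Phi> (- orbit r x) \<le> 0"
      by (intro dom limsup_pprt_le) (auto simp: nonneg)
    then show "0 \<le> (if 0 \<le> x then \<Phi> (orbit r x) else 0)"
      using linear by (simp add: linear_neg)
    fix s assume s: "t0 \<le> s"
    have "\<Phi> (orbit (r + s) x) = \<Phi> (orbit r (S s x))"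
      using dom[OF limsup_pprt_orbit_diff(1)[OF s, of r x]]
        dom[OF limsup_pprt_orbit_diff(2)[OF s, of r x]] linear by (simp add: linear_diff)
    then show "(if 0 \<le> x then \<Phi> (orbit (r + s) x) else 0)
        = (if 0 \<le> S s x then \<Phi> (orbit r (S s x)) else 0)"
      using x nonneg[OF s] by simp
  next
    have "\<Phi> (orbit r x) \<le> M * norm x" for r x
      using M_nonneg order_trans[OF norm_pprt_le norm_le] by (intro dom limsup_pprt_le) auto
    then show "bounded_by M (\<lambda>r x. if 0 \<le> x then \<Phi> (orbit r x) else 0)"
      using M_nonneg by (simp add: bounded_by_def)
  qed (use linear in \<open>simp_all add: orbit_add linear_add\<close>)
qed

theorem shift_difference_tendsto_zero:
  assumes step: "\<And>s t x. 0 \<le> s \<Longrightarrow> s < \<delta> \<Longrightarrow> t1 \<le> t \<Longrightarrow> norm (S (t + s) x - S t x) \<le> \<epsilon> * norm x"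
    and \<epsilon>: "0 \<le> \<epsilon>" "M * \<epsilon> < 1" and \<delta>: "0 < \<delta>" and s: "0 \<le> s"
  shows "((\<lambda>t. S (t + s) x - S t x) \<longlongrightarrow> 0) at_top"
proof -
  have nonneg_case: "((\<lambda>t. S (t + s) y - S t y) \<longlongrightarrow> 0) at_top" if y: "0 \<le> y" for y
  proof (rule Lim_transform_eventually)
    have "\<Phi> (orbit s y - orbit 0 y) = 0" if \<Phi>: "linear \<Phi>" "\<Phi> \<le> limsup_pprt at_top" for \<Phi>
    proof -
      have "(if 0 \<le> y then \<Phi> (orbit (0 + s) y) else 0) = (if 0 \<le> y then \<Phi> (orbit 0 y) else 0)"
        by (rule trajectory_constant[OF step \<epsilon> \<delta> trajectory_functional[OF \<Phi>] s])
      then show ?thesis using y \<Phi>(1) by (simp add: linear_diff)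
    qed
    then show "(apply_bcontfun (orbit s y - orbit 0 y) \<longlongrightarrow> 0) at_top"
      by (rule tendsto_zero_if_dominated_functionals_vanish)
    show "\<forall>\<^sub>F t in at_top. apply_bcontfun (orbit s y - orbit 0 y) t = S (t + s) y - S t y"
      using eventually_ge_at_top[of t0] by eventually_elim (use s in \<open>simp add: max_def\<close>)
  qed
  have "((\<lambda>t. (S (t + s) (pprt x) - S t (pprt x)) - (S (t + s) (pprt (- x)) - S t (pprt (- x))))
      \<longlongrightarrow> 0) at_top"
    using tendsto_diff[OF nonneg_case nonneg_case] by simp
  moreover have "\<forall>\<^sub>F t in at_top.
      (S (t + s) (pprt x) - S t (pprt x)) - (S (t + s) (pprt (- x)) - S t (pprt (- x)))
      = S (t + s) x - S t x"
    using eventually_ge_at_top[of t0]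
  proof eventually_elim
    case (elim t)
    then have "S r x = S r (pprt x) - S r (pprt (- x))" if "t \<le> r" for r
      using that diff[of r "pprt x" "pprt (- x)"] by (simp add: pprt_diff_pprt_uminus)
    from this[of t] this[of "t + s"] show ?case using s by simp
  qed
  ultimately show ?thesis by (rule Lim_transform_eventually)
qed

end

section \<open>Mean ergodic bounded semigroups\<close>

lemma has_integral_mem_closed_subspace:
  fixes f :: "'n::euclidean_space \<Rightarrow> 'b::real_normed_vector"
  assumes int: "(f has_integral I) (cbox a b)" and V: "subspace V" "closed V"
    and mem: "\<And>x. x \<in> cbox a b \<Longrightarrow> f x \<in> V"
  shows "I \<in> V"
proof (rule closed_approachable[OF V(2), THEN iffD1], intro allI impI)
  fix e :: real assume "0 < e"
  then obtain \<gamma> where \<gamma>: "gauge \<gamma>"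
    and fine: "\<And>p. p tagged_division_of cbox a b \<Longrightarrow> \<gamma> fine p \<Longrightarrow>
      norm ((\<Sum>(x, k)\<in>p. measure lborel k *\<^sub>R f x) - I) < e"
    by (rule has_integralD[OF int]) (use that in blast)
  obtain p where p: "p tagged_division_of cbox a b" "\<gamma> fine p"
    using fine_division_exists[OF \<gamma>] .
  have "f x \<in> V" if "(x, k) \<in> p" for x k
    using tagged_division_ofD(2,3)[OF p(1) that] by (intro mem) blast
  then have "(\<Sum>(x, k)\<in>p. measure lborel k *\<^sub>R f x) \<in> V"
    by (intro subspace_sum[OF V(1)]) (auto intro!: subspace_scale[OF V(1)])
  then show "\<exists>v\<in>V. dist v I < e"
    using fine[OF p] by (auto simp: dist_norm)
qed

definition cesaro_mean :: "(real \<Rightarrow> 'b::banach) \<Rightarrow> real \<Rightarrow> 'b" where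
  "cesaro_mean y r = (1 / r) *\<^sub>R integral {0..r} y"

lemma cesaro_mean_tendsto_zero:
  fixes y :: "real \<Rightarrow> 'b::banach"
  assumes cont: "continuous_on {0..} y" and lim: "(y \<longlongrightarrow> 0) at_top"
  shows "(cesaro_mean y \<longlongrightarrow> 0) at_top"
proof (rule tendstoI)
  fix e :: real assume e: "0 < e"
  have "\<forall>\<^sub>F s in at_top. 0 \<le> s \<and> norm (y s) < e / 2"
    using tendstoD[OF lim, of "e / 2"] e by (intro eventually_conj eventually_ge_at_top) auto
  then obtain s0 where s0: "0 \<le> s0" "\<And>s. s0 \<le> s \<Longrightarrow> norm (y s) < e / 2"
    by (auto simp: eventually_at_top_linorder)
  define K where "K = norm (integral {0..s0} y)"
  have cont_on: "continuous_on {a..b} y" if "0 \<le> a" for a b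
    by (rule continuous_on_subset[OF cont]) (use that in auto)
  show "\<forall>\<^sub>F r in at_top. dist (cesaro_mean y r) 0 < e"
    using eventually_gt_at_top[of "max s0 (2 * K / e)"]
  proof eventually_elim
    case (elim r)
    then have r: "s0 \<le> r" "0 < r" "2 * K / e < r" using s0(1) by auto
    have split: "integral {0..r} y = integral {0..s0} y + integral {s0..r} y"
      using r s0(1)
      by (intro Henstock_Kurzweil_Integration.integral_combine[symmetric]
          integrable_continuous_interval cont_on) auto
    have "norm (integral {s0..r} y) \<le> e / 2 * (r - s0)"
      using r s0 by (intro integral_bound cont_on) (auto intro: less_imp_le)
    then have "norm (integral {0..r} y) \<le> K + e / 2 * (r - s0)"
      unfolding split K_def by (intro norm_triangle_le add_left_mono)
    also have "\<dots> \<le> K + e / 2 * r" using e s0(1) by simp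
    also have "\<dots> < e * r" using r e by (simp add: field_simps)
    finally show ?case using r by (simp add: cesaro_mean_def field_simps)
  qed
qed

lemma cesaro_mean_diff:
  assumes "y integrable_on {0..r}" "z integrable_on {0..r}"
  shows "cesaro_mean (\<lambda>s. y s - z s) r = cesaro_mean y r - cesaro_mean z r"
  using assms by (simp add: cesaro_mean_def integral_diff scaleR_diff_right)

lemma cesaro_mean_const: "0 < r \<Longrightarrow> cesaro_mean (\<lambda>_. c) r = c"
  by (simp add: cesaro_mean_def)

lemma cesaro_mean_tendsto:
  fixes y :: "real \<Rightarrow> 'b::banach"
  assumes cont: "continuous_on {0..} y" and lim: "(y \<longlongrightarrow> l) at_top"
  shows "(cesaro_mean y \<longlongrightarrow> l) at_top"
proof -
  have "(cesaro_mean (\<lambda>s. y s - l) \<longlongrightarrow> 0) at_top"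
    by (intro cesaro_mean_tendsto_zero continuous_intros cont LIM_zero lim)
  moreover have "\<forall>\<^sub>F r in at_top. cesaro_mean (\<lambda>s. y s - l) r = cesaro_mean y r - l"
    using eventually_gt_at_top[of 0]
  proof eventually_elim
    case (elim r)
    have "y integrable_on {0..r}"
      by (intro integrable_continuous_interval continuous_on_subset[OF cont]) auto
    then show ?case
      using elim by (simp add: cesaro_mean_diff integrable_const_ivl cesaro_mean_const)
  qed
  ultimately have "((\<lambda>r. cesaro_mean y r - l) \<longlongrightarrow> 0) at_top"
    by (rule Lim_transform_eventually)
  then show ?thesis by (rule LIM_zero_cancel)
qed

definition stable_vectors :: "(real \<Rightarrow> 'b::real_normed_vector \<Rightarrow> 'b) \<Rightarrow> 'b set" where
  "stable_vectors T = {f. ((\<lambda>t. T t f) \<longlongrightarrow> 0) at_top}"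

locale bounded_C0_semigroup =
  fixes T :: "real \<Rightarrow> 'b::banach \<Rightarrow> 'b" and M :: real
  assumes bounded_linear: "0 \<le> t \<Longrightarrow> bounded_linear (T t)"
    and plus: "0 \<le> s \<Longrightarrow> 0 \<le> t \<Longrightarrow> T (s + t) f = T s (T t f)"
    and continuous: "continuous_on {0..} (\<lambda>t. T t f)"
    and norm_le: "0 \<le> t \<Longrightarrow> norm (T t f) \<le> M * norm f"
    and M_pos: "0 < M"
begin

lemma
  assumes "0 \<le> t"
  shows add: "T t (f + g) = T t f + T t g"
    and diff: "T t (f - g) = T t f - T t g"
    and scaleR: "T t (c *\<^sub>R f) = c *\<^sub>R T t f"
  using bounded_linear[OF assms, THEN bounded_linear.linear]
  by (simp_all add: linear_add linear_diff linear_scale)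

lemma integrable_orbit: "(\<lambda>s. T s f) integrable_on {0..r}"
  by (rule integrable_continuous_interval) (auto intro: continuous_on_subset[OF continuous])

lemma subspace_stable_vectors: "subspace (stable_vectors T)"
proof (rule subspaceI)
  have "\<forall>\<^sub>F t in at_top. T t 0 = 0"
    using eventually_ge_at_top[of 0]
    by eventually_elim (rule linear_0[OF bounded_linear.linear[OF bounded_linear]])
  then show "0 \<in> stable_vectors T"
    by (simp add: stable_vectors_def tendsto_eventually)
next
  fix f g assume fg: "f \<in> stable_vectors T" "g \<in> stable_vectors T"
  have "\<forall>\<^sub>F t in at_top. T t f + T t g = T t (f + g)"
    using eventually_ge_at_top[of 0] by eventually_elim (simp add: add)
  moreover have "((\<lambda>t. T t f + T t g) \<longlongrightarrow> 0) at_top"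
    using fg by (simp add: stable_vectors_def tendsto_add_zero)
  ultimately show "f + g \<in> stable_vectors T"
    by (auto simp: stable_vectors_def intro: Lim_transform_eventually)
next
  fix c f assume f: "f \<in> stable_vectors T"
  have "\<forall>\<^sub>F t in at_top. c *\<^sub>R T t f = T t (c *\<^sub>R f)"
    using eventually_ge_at_top[of 0] by eventually_elim (simp add: scaleR)
  moreover have "((\<lambda>t. c *\<^sub>R T t f) \<longlongrightarrow> c *\<^sub>R 0) at_top"
    using f by (intro tendsto_scaleR tendsto_const) (simp add: stable_vectors_def)
  ultimately show "c *\<^sub>R f \<in> stable_vectors T"
    by (auto simp: stable_vectors_def intro: Lim_transform_eventually)
qed

lemma closed_stable_vectors: "closed (stable_vectors T)"
proof -
  have "f \<in> stable_vectors T" if f: "f \<in> closure (stable_vectors T)" for f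
    unfolding stable_vectors_def
  proof (intro CollectI tendstoI)
    fix e :: real assume "0 < e"
    then have "0 < e / (2 * M)" using M_pos by simp
    then obtain g where g: "g \<in> stable_vectors T" "dist g f < e / (2 * M)"
      using f unfolding closure_approachable by blast
    have "\<forall>\<^sub>F t in at_top. norm (T t g) < e / 2"
      using tendstoD[of "\<lambda>t. T t g" 0 at_top "e / 2"] g(1) \<open>0 < e\<close> by (simp add: stable_vectors_def)
    with eventually_ge_at_top[of 0] show "\<forall>\<^sub>F t in at_top. dist (T t f) 0 < e"
    proof eventually_elim
      case (elim t)
      have "norm (T t f) \<le> norm (T t g) + norm (T t (g - f))"
        using norm_triangle_sub[of "T t f" "T t g"] elim(1) by (simp add: diff norm_minus_commute)
      also have "\<dots> < e / 2 + M * (e / (2 * M))"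
      proof (rule add_strict_mono[OF elim(2)])
        have "norm (T t (g - f)) \<le> M * norm (g - f)" by (rule norm_le[OF elim(1)])
        also have "\<dots> < M * (e / (2 * M))"
          using g(2) M_pos by (intro mult_strict_left_mono) (simp_all add: dist_norm)
        finally show "norm (T t (g - f)) < M * (e / (2 * M))" .
      qed
      finally show ?case using M_pos by simp
    qed
  qed
  then show ?thesis by (auto simp: closure_subset_eq[symmetric])
qed

lemma cesaro_mean_diff_mem_stable_vectors:
  assumes stable: "\<And>s. 0 \<le> s \<Longrightarrow> T s f - f \<in> stable_vectors T" and r: "0 < r"
  shows "cesaro_mean (\<lambda>s. T s f) r - f \<in> stable_vectors T"
proof -
  let ?I = "integral {0..r} (\<lambda>s. T s f - f)"
  have "((\<lambda>s. T s f - f) has_integral ?I) (cbox 0 r)"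
    unfolding box_real by (intro integrable_integral integrable_diff integrable_orbit) auto
  then have "?I \<in> stable_vectors T"
    by (rule has_integral_mem_closed_subspace[OF _ subspace_stable_vectors closed_stable_vectors])
      (use stable in auto)
  then have "(1 / r) *\<^sub>R ?I \<in> stable_vectors T"
    by (rule subspace_scale[OF subspace_stable_vectors])
  moreover have "(1 / r) *\<^sub>R ?I = cesaro_mean (\<lambda>s. T s f) r - f"
    unfolding cesaro_mean_def[symmetric]
    by (simp add: cesaro_mean_diff integrable_orbit integrable_const_ivl cesaro_mean_const r)
  ultimately show ?thesis by simp
qed

lemma apply_cesaro_mean_orbit:
  assumes "0 \<le> u"
  shows "T u (cesaro_mean (\<lambda>s. T s f) r) = cesaro_mean (\<lambda>s. T s (T u f)) r"
proof -
  have "T u (integral {0..r} (\<lambda>s. T s f)) = integral {0..r} (\<lambda>s. T u (T s f))"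
    using integral_linear[OF integrable_orbit[of f r] bounded_linear[OF assms]] by (simp add: o_def)
  also have "\<dots> = integral {0..r} (\<lambda>s. T s (T u f))"
    using assms by (intro integral_cong) (auto simp: plus[symmetric] add.commute)
  finally show ?thesis using assms by (simp add: cesaro_mean_def scaleR)
qed

lemma cesaro_limit_fixed:
  assumes u: "0 \<le> u" and stable: "T u f - f \<in> stable_vectors T"
    and mean: "(cesaro_mean (\<lambda>s. T s f) \<longlongrightarrow> g) at_top"
  shows "T u g = g"
proof -
  have mean_diff: "T u (cesaro_mean (\<lambda>s. T s f) r) - cesaro_mean (\<lambda>s. T s f) r
      = cesaro_mean (\<lambda>s. T s (T u f - f)) r" for r
  proof -
    have "cesaro_mean (\<lambda>s. T s (T u f)) r - cesaro_mean (\<lambda>s. T s f) r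
        = cesaro_mean (\<lambda>s. T s (T u f) - T s f) r"
      by (intro cesaro_mean_diff[symmetric] integrable_orbit)
    also have "\<dots> = cesaro_mean (\<lambda>s. T s (T u f - f)) r"
      unfolding cesaro_mean_def
      by (intro arg_cong[where f = "scaleR _"] integral_cong) (simp add: diff)
    finally show ?thesis by (simp add: apply_cesaro_mean_orbit[OF u])
  qed
  have "(cesaro_mean (\<lambda>s. T s (T u f - f)) \<longlongrightarrow> 0) at_top"
    using stable by (intro cesaro_mean_tendsto_zero continuous) (simp add: stable_vectors_def)
  then have "((\<lambda>r. T u (cesaro_mean (\<lambda>s. T s f) r) - cesaro_mean (\<lambda>s. T s f) r) \<longlongrightarrow> 0) at_top"
    by (simp add: mean_diff)
  moreover have "((\<lambda>r. T u (cesaro_mean (\<lambda>s. T s f) r) - cesaro_mean (\<lambda>s. T s f) r)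
      \<longlongrightarrow> T u g - g) at_top"
    by (intro tendsto_diff mean bounded_linear.tendsto[OF bounded_linear[OF u]])
  ultimately have "T u g - g = 0"
    by (rule tendsto_unique[OF trivial_limit_at_top_linorder, rotated])
  then show ?thesis by simp
qed

theorem orbit_tendsto_cesaro_limit:
  assumes stable: "\<And>s. 0 \<le> s \<Longrightarrow> T s f - f \<in> stable_vectors T"
    and mean: "(cesaro_mean (\<lambda>s. T s f) \<longlongrightarrow> g) at_top"
  shows "((\<lambda>t. T t f) \<longlongrightarrow> g) at_top"
proof -
  have "g - f \<in> stable_vectors T"
  proof (rule Lim_in_closed_set[OF closed_stable_vectors])
    show "\<forall>\<^sub>F r in at_top. cesaro_mean (\<lambda>s. T s f) r - f \<in> stable_vectors T"
      using eventually_gt_at_top[of 0]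
      by eventually_elim (rule cesaro_mean_diff_mem_stable_vectors[OF stable])
    show "((\<lambda>r. cesaro_mean (\<lambda>s. T s f) r - f) \<longlongrightarrow> g - f) at_top"
      by (intro tendsto_diff mean tendsto_const)
  qed simp
  then have "((\<lambda>t. g - T t (g - f)) \<longlongrightarrow> g - 0) at_top"
    by (intro tendsto_diff tendsto_const) (simp add: stable_vectors_def)
  moreover have "\<forall>\<^sub>F t in at_top. g - T t (g - f) = T t f"
    using eventually_ge_at_top[of 0]
    by eventually_elim (simp add: diff cesaro_limit_fixed[OF _ stable mean])
  ultimately show ?thesis by (simp add: Lim_transform_eventually)
qed

lemma norm_step_le:
  assumes "norm (T (t1 + s) f - T t1 f) \<le> \<epsilon> * norm f" and "0 \<le> s" "0 \<le> t1" "t1 \<le> t"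
  shows "norm (T (t + s) f - T t f) \<le> M * \<epsilon> * norm f"
proof -
  have "T (t + s) f - T t f = T (t - t1) (T (t1 + s) f - T t1 f)"
    using assms by (simp add: diff plus[symmetric])
  also have "norm \<dots> \<le> M * norm (T (t1 + s) f - T t1 f)"
    using assms by (intro norm_le) simp
  also have "\<dots> \<le> M * (\<epsilon> * norm f)"
    using assms(1) M_pos by (intro mult_left_mono) auto
  finally show ?thesis by (simp add: mult.assoc)
qed

end

section \<open>Semigroups on complex Banach lattices\<close>

definition real_part :: "('a::zero \<times> 'a \<Rightarrow> 'a \<times> 'a) \<Rightarrow> 'a \<Rightarrow> 'a" where
  "real_part A x = fst (A (x, 0))"

lemma norm_real_part_diff_le:
  fixes A B :: "'a::real_normed_vector \<times> 'a \<Rightarrow> 'a \<times> 'a"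
  shows "norm (real_part A x - real_part B x) \<le> norm (A (x, 0) - B (x, 0))"
  unfolding real_part_def by (metis fst_diff norm_fst_le prod.collapse)

context
  fixes A :: "'a::banach_lattice \<times> 'a \<Rightarrow> 'a \<times> 'a"
  assumes A: "complex_bounded_linear A" and positive: "positive_op A"
begin

lemma positive_op_apply_real: "A (x, 0) = (real_part A x, 0)"
proof -
  have "snd (A (y, 0)) = 0" if "0 \<le> y" for y
    using positive that by (auto simp: positive_op_def cpos_def)
  moreover have "A (x, 0) = A (pprt x, 0) - A (pprt (- x), 0)"
    using A linear_diff[of A "(pprt x, 0)" "(pprt (- x), 0)"]
    by (simp add: complex_bounded_linear_def bounded_linear.linear pprt_diff_pprt_uminus)
  ultimately show ?thesis by (simp add: real_part_def prod_eq_iff)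
qed

lemma positive_op_apply: "A f = (real_part A (fst f), real_part A (snd f))"
proof -
  have "A f = A ((fst f, 0) + cscale \<i> (snd f, 0))"
    by (simp add: cscale_def)
  also have "\<dots> = A (fst f, 0) + cscale \<i> (A (snd f, 0))"
    using A linear_add[of A "(fst f, 0)" "cscale \<i> (snd f, 0)"]
    by (simp only: complex_bounded_linear_def bounded_linear.linear)
  finally show ?thesis by (simp add: positive_op_apply_real cscale_def)
qed

end

lemma
  assumes "C0_semigroup T"
  shows C0_semigroup_complex_bounded_linear: "0 \<le> t \<Longrightarrow> complex_bounded_linear (T t)"
    and C0_semigroup_bounded_linear: "0 \<le> t \<Longrightarrow> bounded_linear (T t)"
    and C0_semigroup_plus: "0 \<le> s \<Longrightarrow> 0 \<le> t \<Longrightarrow> T (s + t) f = T s (T t f)"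
    and C0_semigroup_continuous: "continuous_on {0..} (\<lambda>t. T t f)"
  using assms by (simp_all add: C0_semigroup_def complex_bounded_linear_def del: split_paired_All)

lemma bounded_C0_semigroup_exists:
  fixes T :: "real \<Rightarrow> 'a::banach \<times> 'a \<Rightarrow> 'a \<times> 'a"
  assumes T: "C0_semigroup T" and "bounded_semigroup T"
  obtains M where "bounded_C0_semigroup T M"
proof -
  obtain M where M: "\<And>t. 0 \<le> t \<Longrightarrow> onorm (T t) \<le> M"
    using assms(2) by (auto simp: bounded_semigroup_def)
  have "norm (T t f) \<le> max 1 M * norm f" if "0 \<le> t" for t f
  proof -
    have "norm (T t f) \<le> onorm (T t) * norm f"
      by (rule onorm[OF C0_semigroup_bounded_linear[OF T that]])
    also have "\<dots> \<le> max 1 M * norm f"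
      using M[OF that] by (intro mult_right_mono) auto
    finally show ?thesis .
  qed
  then have "bounded_C0_semigroup T (max 1 M)"
    by (intro bounded_C0_semigroup.intro C0_semigroup_bounded_linear[OF T] C0_semigroup_plus[OF T]
        C0_semigroup_continuous[OF T]) simp_all
  then show thesis by (rule that)
qed

lemma eventually_positive_semigroup_real_part:
  fixes T :: "real \<Rightarrow> 'a::banach_lattice \<times> 'a \<Rightarrow> 'a \<times> 'a"
  assumes T: "C0_semigroup T" and bounded: "bounded_C0_semigroup T M"
    and t0: "0 \<le> t0" and pos: "\<And>t. t0 \<le> t \<Longrightarrow> positive_op (T t)"
  shows "eventually_positive_semigroup (\<lambda>t. real_part (T t)) t0 M"
proof -
  interpret bounded_C0_semigroup T M by (rule bounded)
  show ?thesis
  proof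
    fix t assume t: "t0 \<le> t"
    then have "0 \<le> t" using t0 by simp
    then show "real_part (T t) (x + y) = real_part (T t) x + real_part (T t) y" for x y
      using add[of t "(x, 0)" "(y, 0)"] by (simp add: real_part_def)
    show "0 \<le> real_part (T t) x" if "0 \<le> x" for x
      using pos[OF t] that by (auto simp: positive_op_def cpos_def real_part_def)
    show "norm (real_part (T t) x) \<le> M * norm x" for x
      using norm_le[OF \<open>0 \<le> t\<close>, of "(x, 0)"] norm_fst_le[of "real_part (T t) x" "snd (T t (x, 0))"]
      by (simp add: real_part_def norm_Pair)
    have real: "T t (x, 0) = (real_part (T t) x, 0)" for x
      by (rule positive_op_apply_real[OF C0_semigroup_complex_bounded_linear[OF T] pos]; fact)
    show "real_part (T (s + t)) x = real_part (T s) (real_part (T t) x)" if "t0 \<le> s" for s x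
    proof -
      have "real_part (T (s + t)) x = fst (T s (T t (x, 0)))"
        using that t0 \<open>0 \<le> t\<close> by (simp add: real_part_def plus)
      also have "\<dots> = real_part (T s) (real_part (T t) x)"
        by (simp only: real) (simp add: real_part_def)
      finally show ?thesis .
    qed
  next
    show "continuous_on {t0..} (\<lambda>t. real_part (T t) x)" for x
      unfolding real_part_def
      by (intro continuous_on_fst continuous_on_subset[OF continuous]) (use t0 in auto)
  qed (use t0 M_pos in auto)
qed

lemma growth_bound_nonpos:
  assumes "bounded_semigroup T"
  shows "growth_bound T \<le> 0"
proof -
  obtain M where "\<forall>t\<ge>0. onorm (T t) \<le> M * exp (0 * t)"
    using assms by (auto simp: bounded_semigroup_def)
  then show ?thesis
    unfolding growth_bound_def zero_ereal_def by (intro Inf_lower) blast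
qed

lemma mem_stable_vectors_if_growth_bound_neg:
  assumes T: "C0_semigroup T" and neg: "growth_bound T < 0"
  shows "f \<in> stable_vectors T"
proof -
  obtain \<omega> K where \<omega>: "\<omega> < 0" and bound: "\<And>t. 0 \<le> t \<Longrightarrow> onorm (T t) \<le> K * exp (\<omega> * t)"
    using neg unfolding growth_bound_def Inf_less_iff by auto blast
  have "((\<lambda>t. T t f) \<longlongrightarrow> 0) at_top"
  proof (rule Lim_null_comparison)
    show "\<forall>\<^sub>F t in at_top. norm (T t f) \<le> K * exp (\<omega> * t) * norm f"
      using eventually_ge_at_top[of 0]
    proof eventually_elim
      case (elim t)
      have "norm (T t f) \<le> onorm (T t) * norm f"
        by (rule onorm[OF C0_semigroup_bounded_linear[OF T elim]])
      also have "\<dots> \<le> K * exp (\<omega> * t) * norm f"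
        by (intro mult_right_mono bound elim) auto
      finally show ?case .
    qed
    have "filterlim (\<lambda>t. \<omega> * t) at_bot at_top"
      using \<omega> by (intro filterlim_tendsto_neg_mult_at_bot[OF tendsto_const _ filterlim_ident])
    then have "((\<lambda>t. exp (\<omega> * t)) \<longlongrightarrow> 0) at_top"
      by (rule filterlim_compose[OF exp_at_bot])
    then show "((\<lambda>t. K * exp (\<omega> * t) * norm f) \<longlongrightarrow> 0) at_top"
      by (intro tendsto_mult_left_zero tendsto_mult_right_zero)
  qed
  then show ?thesis by (simp add: stable_vectors_def)
qed

lemma norm_continuous_at_infinity_step:
  assumes T: "C0_semigroup T" and cont: "norm_continuous_at_infinity T" "growth_bound T = 0"
    and \<epsilon>: "0 < \<epsilon>"
  obtains t1 \<delta> where "0 \<le> t1" "0 < \<delta>"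
    "\<And>s f. 0 \<le> s \<Longrightarrow> s < \<delta> \<Longrightarrow> norm (T (t1 + s) f - T t1 f) \<le> \<epsilon> * norm f"
proof -
  let ?osc = "\<lambda>t. Limsup (at 0) (\<lambda>s. ereal (onorm (\<lambda>f. T t f - T (t + s) f)))"
  have "(?osc \<longlongrightarrow> 0) at_top"
    using cont by (simp add: norm_continuous_at_infinity_def)
  then have "\<forall>\<^sub>F t in at_top. ?osc t < ereal \<epsilon>"
    by (rule order_tendstoD(2)) (use \<epsilon> in simp)
  then have "\<forall>\<^sub>F t in at_top. 0 \<le> t \<and> ?osc t < ereal \<epsilon>"
    using eventually_ge_at_top by (rule eventually_conj[rotated])
  then obtain t1 where t1: "0 \<le> t1" "?osc t1 < ereal \<epsilon>"
    using eventually_happens'[OF trivial_limit_at_top_linorder] by blast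
  from Limsup_lessD[OF t1(2)] obtain \<delta> where \<delta>: "0 < \<delta>"
    "\<And>s. s \<noteq> 0 \<Longrightarrow> \<bar>s\<bar> < \<delta> \<Longrightarrow> onorm (\<lambda>f. T t1 f - T (t1 + s) f) < \<epsilon>"
    by (auto simp: eventually_at dist_norm)
  have "norm (T (t1 + s) f - T t1 f) \<le> \<epsilon> * norm f" if s: "0 \<le> s" "s < \<delta>" for s f
  proof (cases "s = 0")
    case False
    have "norm (T t1 f - T (t1 + s) f) \<le> onorm (\<lambda>f. T t1 f - T (t1 + s) f) * norm f"
      using t1 s by (intro onorm bounded_linear_sub C0_semigroup_bounded_linear[OF T]) auto
    also have "\<dots> \<le> \<epsilon> * norm f"
      using \<delta>(2)[of s] False s by (intro mult_right_mono) auto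
    finally show ?thesis by (simp add: norm_minus_commute)
  qed (use \<epsilon> in auto)
  with t1(1) \<delta>(1) show thesis by (rule that)
qed

lemma shift_difference_tendsto_zero_if_growth_bound_zero:
  fixes T :: "real \<Rightarrow> 'a::banach_lattice \<times> 'a \<Rightarrow> 'a \<times> 'a"
  assumes T: "C0_semigroup T" and bounded: "bounded_C0_semigroup T M"
    and positive: "uniformly_eventually_positive T"
    and cont: "norm_continuous_at_infinity T" "growth_bound T = 0" and s: "0 \<le> s"
  shows "((\<lambda>t. T (t + s) f - T t f) \<longlongrightarrow> 0) at_top"
proof -
  interpret bounded_C0_semigroup T M by (rule bounded)
  define S where "S t = real_part (T t)" for t
  obtain t0 where t0: "0 \<le> t0" and pos: "\<And>t. t0 \<le> t \<Longrightarrow> positive_op (T t)"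
    using positive by (auto simp: uniformly_eventually_positive_def)
  interpret S: eventually_positive_semigroup S t0 M
    unfolding S_def by (rule eventually_positive_semigroup_real_part[OF T bounded t0 pos])
  define \<epsilon> where "\<epsilon> = 1 / (2 * M * M)"
  have \<epsilon>: "0 < \<epsilon>" "0 \<le> M * \<epsilon>" "M * (M * \<epsilon>) < 1" using M_pos by (auto simp: \<epsilon>_def)
  obtain t1 \<delta> where t1: "0 \<le> t1" and \<delta>: "0 < \<delta>"
    and step: "\<And>r f. 0 \<le> r \<Longrightarrow> r < \<delta> \<Longrightarrow> norm (T (t1 + r) f - T t1 f) \<le> \<epsilon> * norm f"
    using norm_continuous_at_infinity_step[OF T cont \<epsilon>(1)] by blast
  have "norm (S (t + r) x - S t x) \<le> M * \<epsilon> * norm x" if "0 \<le> r" "r < \<delta>" "t1 \<le> t" for r t x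
  proof -
    have "norm (S (t + r) x - S t x) \<le> norm (T (t + r) (x, 0) - T t (x, 0))"
      unfolding S_def by (rule norm_real_part_diff_le)
    also have "\<dots> \<le> M * \<epsilon> * norm (x, 0::'a)"
      by (rule norm_step_le[OF step[OF that(1,2)] that(1) t1 that(3)])
    finally show ?thesis by (simp add: norm_Pair)
  qed
  from S.shift_difference_tendsto_zero[OF this \<epsilon>(2,3) \<delta> s]
  have "((\<lambda>t. (S (t + s) (fst f) - S t (fst f), S (t + s) (snd f) - S t (snd f))) \<longlongrightarrow> (0, 0)) at_top"
    by (intro tendsto_Pair)
  moreover have "\<forall>\<^sub>F t in at_top. (S (t + s) (fst f) - S t (fst f), S (t + s) (snd f) - S t (snd f))
      = T (t + s) f - T t f"
    using eventually_ge_at_top[of t0]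
  proof eventually_elim
    case (elim t)
    then have "T r f = (S r (fst f), S r (snd f))" if "t \<le> r" for r
      unfolding S_def using that t0
      by (intro positive_op_apply C0_semigroup_complex_bounded_linear[OF T] pos) auto
    from this[of t] this[of "t + s"] show ?case using s by simp
  qed
  ultimately show ?thesis by (simp add: zero_prod_def Lim_transform_eventually)
qed

lemma shift_difference_mem_stable_vectors:
  fixes T :: "real \<Rightarrow> 'a::banach_lattice \<times> 'a \<Rightarrow> 'a \<times> 'a"
  assumes T: "C0_semigroup T" and positive: "uniformly_eventually_positive T"
    and bounded: "bounded_semigroup T" and cont: "norm_continuous_at_infinity T" and s: "0 \<le> s"
  shows "T s f - f \<in> stable_vectors T"
proof (cases "growth_bound T < 0")
  case True
  then show ?thesis by (rule mem_stable_vectors_if_growth_bound_neg[OF T])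
next
  case False
  then have zero: "growth_bound T = 0"
    using growth_bound_nonpos[OF bounded] by simp
  obtain M where M: "bounded_C0_semigroup T M"
    using bounded_C0_semigroup_exists[OF T bounded] .
  interpret bounded_C0_semigroup T M by (rule M)
  have "((\<lambda>t. T (t + s) f - T t f) \<longlongrightarrow> 0) at_top"
    by (rule shift_difference_tendsto_zero_if_growth_bound_zero[OF T M positive cont zero s])
  moreover have "\<forall>\<^sub>F t in at_top. T (t + s) f - T t f = T t (T s f - f)"
    using eventually_ge_at_top[of 0] by eventually_elim (simp add: s diff plus)
  ultimately show ?thesis
    by (auto simp: stable_vectors_def intro: Lim_transform_eventually)
qed

theorem theorem3p1:
  fixes T :: "real \<Rightarrow> 'a::banach_lattice \<times> 'a \<Rightarrow> 'a \<times> 'a"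
  assumes "C0_semigroup T"
    and "uniformly_eventually_positive T"
    and "bounded_semigroup T"
    and "norm_continuous_at_infinity T"
  shows "(\<forall>f. \<exists>g. ((\<lambda>t. T t f) \<longlongrightarrow> g) at_top) \<longleftrightarrow> mean_ergodic T"
proof -
  have mean_ergodic_iff: "mean_ergodic T \<longleftrightarrow> (\<forall>f. \<exists>g. (cesaro_mean (\<lambda>s. T s f) \<longlongrightarrow> g) at_top)"
    by (simp add: mean_ergodic_def cesaro_mean_def[abs_def])
  obtain M where "bounded_C0_semigroup T M"
    using bounded_C0_semigroup_exists[OF assms(1,3)] .
  then interpret bounded_C0_semigroup T M .
  have "(cesaro_mean (\<lambda>s. T s f) \<longlongrightarrow> g) at_top" if "((\<lambda>t. T t f) \<longlongrightarrow> g) at_top" for f g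
    using continuous that by (rule cesaro_mean_tendsto)
  moreover have "((\<lambda>t. T t f) \<longlongrightarrow> g) at_top" if "(cesaro_mean (\<lambda>s. T s f) \<longlongrightarrow> g) at_top" for f g
    using shift_difference_mem_stable_vectors[OF assms] that by (rule orbit_tendsto_cesaro_limit)
  ultimately show ?thesis unfolding mean_ergodic_iff by blast
qed

end
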